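(* Let $\mathbb{F}$ be an infinite field, let $d\ge n\ge 1$ be integers, and let $G_d=GL_d(\mathbb{F})$. The category of finite-dimensional left $\mathbb{F}G_d$-modules whose coefficient functions lie in $\mathcal{A}_{\mathbf{n}}(d)=\bigoplus_{r=0}^n\mathcal{A}(d,r)$ is equivalent to the category of finite-dimensional left $\mathcal{S}_{\mathbb{F}}(d,\mathbf{n})$-modules, where $\mathcal{S}_{\mathbb{F}}(d,\mathbf{n})$ is the extended Schur algebra.
   Context: Notation: $\mathbf{n}=\{1,\dots,n\}$, $\mathbf{d}=\{1,\dots,d\}$. $c_{i,j}:G_d\to\mathbb{F}$ is the $(i,j)$-entry function ($1\le i,j\le d$). $\mathcal{A}(d)=\mathbb{F}[c_{i,j}]$ is the polynomial algebra in the $c_{i,j}$ (viewed as functions on $G_d$), and $\mathcal{A}(d,r)$ is its subspace of homogeneous polynomials of degree $r$. For $X\subseteq\mathbf{n}$, $\Gamma_X(d)$ is the set of all maps $X\to\mathbf{d}$ ($\Gamma_\emptyset(d)$ has one element). For $\alpha,\beta\in\Gamma_X(d)$, $c_{\alpha,\beta}=\prod_{x\in X}c_{\alpha(x),\beta(x)}$ (equal to $1$ if $X=\emptyset$). Extended Schur algebra: $\mathcal{A}_{\mathbf{n}}(d)=\bigoplus_{r=0}^n\mathcal{A}(d,r)$ is spanned by all $c_{\alpha,\beta}$ with $\alpha,\beta\in\Gamma_X(d)$, $X\subseteq\mathbf{n}$. It is a coalgebra with $\Delta(c_{\alpha,\beta})=\sum_{\gamma\in\Gamma_X(d)}c_{\alpha,\gamma}\otimes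 c_{\gamma,\beta}$ and counit $\epsilon(c_{\alpha,\beta})=\delta_{\alpha,\beta}$. The extended Schur algebra is the dual algebra $\mathcal{S}_{\mathbb{F}}(d,\mathbf{n})=\mathrm{Hom}_{\mathbb{F}}(\mathcal{A}_{\mathbf{n}}(d),\mathbb{F})$, with product $(\xi\eta)(c_{\alpha,\beta})=\sum_{\gamma\in\Gamma_X(d)}\xi(c_{\alpha,\gamma})\eta(c_{\gamma,\beta})$ for $\alpha,\beta\in\Gamma_X(d)$ and unit $\epsilon$. Coefficient functions: if $W$ is a finite-dimensional left $\mathbb{F}G_d$-module with basis $\{v_b\}_{b\in B}$, its coefficient functions are the functions $\alpha_{a,b}:G_d\to\mathbb{F}$ given by $g\cdot v_b=\sum_{a\in B}\alpha_{a,b}(g)v_a$; the condition that they all lie in $\mathcal{A}_{\mathbf{n}}(d)$ does not depend on the basis. Morphisms in both categories are module homomorphisms. *)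

theory Defs
  imports "Jordan_Normal_Form.VS_Connect"
begin

section \<open>Categories and their equivalence\<close>

record ('o, 'm) cat =
  Obj :: "'o set"
  Hom :: "'o \<Rightarrow> 'o \<Rightarrow> 'm set"
  Ident :: "'o \<Rightarrow> 'm"
  Comp :: "'o \<Rightarrow> 'o \<Rightarrow> 'o \<Rightarrow> 'm \<Rightarrow> 'm \<Rightarrow> 'm"

text \<open>\<open>Comp C X Y Z g f\<close> is the composite of \<open>f : X \<rightarrow> Y\<close> followed by \<open>g : Y \<rightarrow> Z\<close>.\<close>

locale category =
  fixes C :: "('o, 'm) cat"
  assumes ident_in_hom: "X \<in> Obj C \<Longrightarrow> Ident C X \<in> Hom C X X"
    and comp_in_hom: "\<lbrakk>X \<in> Obj C; Y \<in> Obj C; Z \<in> Obj C; f \<in> Hom C X Y; g \<in> Hom C Y Z\<rbrakk>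
      \<Longrightarrow> Comp C X Y Z g f \<in> Hom C X Z"
    and comp_ident_right: "\<lbrakk>X \<in> Obj C; Y \<in> Obj C; f \<in> Hom C X Y\<rbrakk>
      \<Longrightarrow> Comp C X X Y f (Ident C X) = f"
    and comp_ident_left: "\<lbrakk>X \<in> Obj C; Y \<in> Obj C; f \<in> Hom C X Y\<rbrakk>
      \<Longrightarrow> Comp C X Y Y (Ident C Y) f = f"
    and comp_assoc: "\<lbrakk>W \<in> Obj C; X \<in> Obj C; Y \<in> Obj C; Z \<in> Obj C;
        f \<in> Hom C W X; g \<in> Hom C X Y; h \<in> Hom C Y Z\<rbrakk>
      \<Longrightarrow> Comp C W Y Z h (Comp C W X Y g f) = Comp C W X Z (Comp C X Y Z h g) f"

locale cat_functor = C: category C + D: category D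
  for C :: "('o, 'm) cat" and D :: "('p, 'q) cat" +
  fixes Fo :: "'o \<Rightarrow> 'p" and Fm :: "'o \<Rightarrow> 'o \<Rightarrow> 'm \<Rightarrow> 'q"
  assumes obj_map: "X \<in> Obj C \<Longrightarrow> Fo X \<in> Obj D"
    and hom_map: "\<lbrakk>X \<in> Obj C; Y \<in> Obj C; f \<in> Hom C X Y\<rbrakk> \<Longrightarrow> Fm X Y f \<in> Hom D (Fo X) (Fo Y)"
    and ident_map: "X \<in> Obj C \<Longrightarrow> Fm X X (Ident C X) = Ident D (Fo X)"
    and comp_map: "\<lbrakk>X \<in> Obj C; Y \<in> Obj C; Z \<in> Obj C; f \<in> Hom C X Y; g \<in> Hom C Y Z\<rbrakk>
      \<Longrightarrow> Fm X Z (Comp C X Y Z g f) = Comp D (Fo X) (Fo Y) (Fo Z) (Fm Y Z g) (Fm X Y f)"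

definition cat_iso :: "('o, 'm) cat \<Rightarrow> 'o \<Rightarrow> 'o \<Rightarrow> 'm \<Rightarrow> bool" where
  "cat_iso C X Y f \<longleftrightarrow> f \<in> Hom C X Y \<and>
     (\<exists>g\<in>Hom C Y X. Comp C X Y X g f = Ident C X \<and> Comp C Y X Y f g = Ident C Y)"

definition naturally_isomorphic ::
  "('o, 'm) cat \<Rightarrow> ('p, 'q) cat \<Rightarrow> ('o \<Rightarrow> 'p) \<Rightarrow> ('o \<Rightarrow> 'o \<Rightarrow> 'm \<Rightarrow> 'q)
    \<Rightarrow> ('o \<Rightarrow> 'p) \<Rightarrow> ('o \<Rightarrow> 'o \<Rightarrow> 'm \<Rightarrow> 'q) \<Rightarrow> bool" where
  "naturally_isomorphic C D Fo Fm Go Gm \<longleftrightarrow> (\<exists>\<eta>.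
     (\<forall>X\<in>Obj C. cat_iso D (Fo X) (Go X) (\<eta> X)) \<and>
     (\<forall>X\<in>Obj C. \<forall>Y\<in>Obj C. \<forall>f\<in>Hom C X Y.
        Comp D (Fo X) (Fo Y) (Go Y) (\<eta> Y) (Fm X Y f)
        = Comp D (Fo X) (Go X) (Go Y) (Gm X Y f) (\<eta> X)))"

definition equivalent_categories :: "('o, 'm) cat \<Rightarrow> ('p, 'q) cat \<Rightarrow> bool" where
  "equivalent_categories C D \<longleftrightarrow> (\<exists>Fo Fm Go Gm.
     cat_functor C D Fo Fm \<and> cat_functor D C Go Gm \<and>
     naturally_isomorphic C C (\<lambda>X. Go (Fo X)) (\<lambda>X Y f. Gm (Fo X) (Fo Y) (Fm X Y f))
       (\<lambda>X. X) (\<lambda>X Y f. f) \<and>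
     naturally_isomorphic D D (\<lambda>X. Fo (Go X)) (\<lambda>X Y f. Fm (Go X) (Go Y) (Gm X Y f))
       (\<lambda>X. X) (\<lambda>X Y f. f))"

definition full_subcategory :: "('o, 'm) cat \<Rightarrow> ('o \<Rightarrow> bool) \<Rightarrow> ('o, 'm) cat" where
  "full_subcategory C P = C\<lparr>Obj := {X \<in> Obj C. P X}\<rparr>"

section \<open>Left modules over algebras\<close>

text \<open>
  The locales \<open>module\<close> and \<open>algebra\<close> of the library require commutative rings, so the
  noncommutative versions are spelled out here, over the library's records. An algebra over a
  field is a record whose ring fields are the ring structure and whose \<open>smult\<close> is the action of
  the scalars. For modules only the fields \<open>carrier\<close>, \<open>zero\<close>, \<open>add\<close>, \<open>smult\<close> are relevant.
\<close>

locale assoc_algebra =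
  fixes A :: "('f::field, 'a) module" (structure)
  assumes vectorspace: "vectorspace (class_ring :: 'f ring) A"
    and ring: "ring A"
    and smult_mult_left: "\<lbrakk>x \<in> carrier A; y \<in> carrier A\<rbrakk>
      \<Longrightarrow> (c \<odot>\<^bsub>A\<^esub> x) \<otimes>\<^bsub>A\<^esub> y = c \<odot>\<^bsub>A\<^esub> (x \<otimes>\<^bsub>A\<^esub> y)"
    and smult_mult_right: "\<lbrakk>x \<in> carrier A; y \<in> carrier A\<rbrakk>
      \<Longrightarrow> x \<otimes>\<^bsub>A\<^esub> (c \<odot>\<^bsub>A\<^esub> y) = c \<odot>\<^bsub>A\<^esub> (x \<otimes>\<^bsub>A\<^esub> y)"

locale left_module = assoc_algebra A + abelian_group M
  for A :: "('f::field, 'a) module" and M :: "('a, 'v) module" +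
  assumes act_closed: "\<lbrakk>a \<in> carrier A; v \<in> carrier M\<rbrakk> \<Longrightarrow> a \<odot>\<^bsub>M\<^esub> v \<in> carrier M"
    and act_add_left: "\<lbrakk>a \<in> carrier A; b \<in> carrier A; v \<in> carrier M\<rbrakk>
      \<Longrightarrow> (a \<oplus>\<^bsub>A\<^esub> b) \<odot>\<^bsub>M\<^esub> v = a \<odot>\<^bsub>M\<^esub> v \<oplus>\<^bsub>M\<^esub> b \<odot>\<^bsub>M\<^esub> v"
    and act_add_right: "\<lbrakk>a \<in> carrier A; v \<in> carrier M; w \<in> carrier M\<rbrakk>
      \<Longrightarrow> a \<odot>\<^bsub>M\<^esub> (v \<oplus>\<^bsub>M\<^esub> w) = a \<odot>\<^bsub>M\<^esub> v \<oplus>\<^bsub>M\<^esub> a \<odot>\<^bsub>M\<^esub> w"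
    and act_mult: "\<lbrakk>a \<in> carrier A; b \<in> carrier A; v \<in> carrier M\<rbrakk>
      \<Longrightarrow> (a \<otimes>\<^bsub>A\<^esub> b) \<odot>\<^bsub>M\<^esub> v = a \<odot>\<^bsub>M\<^esub> (b \<odot>\<^bsub>M\<^esub> v)"
    and act_one: "v \<in> carrier M \<Longrightarrow> \<one>\<^bsub>A\<^esub> \<odot>\<^bsub>M\<^esub> v = v"

text \<open>The vector space underlying a module: a scalar \<open>c\<close> acts as \<open>c \<cdot> 1\<close>.\<close>

definition underlying_space ::
  "('f::field, 'a) module \<Rightarrow> ('a, 'v) module \<Rightarrow> ('f, 'v) module" where
  "underlying_space A M =
     \<lparr>carrier = carrier M, mult = mult M, one = one M, zero = zero M, add = add M,
      smult = (\<lambda>c v. (c \<odot>\<^bsub>A\<^esub> \<one>\<^bsub>A\<^esub>) \<odot>\<^bsub>M\<^esub> v)\<rparr>"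

definition fd_left_module :: "('f::field, 'a) module \<Rightarrow> ('a, 'v) module \<Rightarrow> bool" where
  "fd_left_module A M \<longleftrightarrow> left_module A M \<and>
     vectorspace.fin_dim (class_ring :: 'f ring) (underlying_space A M)"

text \<open>
  Morphisms are extensional functions, so that they are determined by their values on the carrier.
\<close>

definition fd_module_category ::
  "('f::field, 'a) module \<Rightarrow> (('a, 'v) module, 'v \<Rightarrow> 'v) cat" where
  "fd_module_category A =
     \<lparr>Obj = {M. fd_left_module A M},
      Hom = (\<lambda>M N. LinearCombinations.module_hom A M N \<inter> extensional (carrier M)),
      Ident = (\<lambda>M. \<lambda>v\<in>carrier M. v),
      Comp = (\<lambda>L M N g f. compose (carrier L) g f)\<rparr>"

section \<open>Group algebras and the general linear group\<close>

definition group_algebra :: "('g, 'b) monoid_scheme \<Rightarrow> ('f::field, 'g \<Rightarrow> 'f) module" where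
  "group_algebra G =
     \<lparr>carrier = {a. finite {g. a g \<noteq> 0} \<and> {g. a g \<noteq> 0} \<subseteq> carrier G},
      mult = (\<lambda>a b g. \<Sum>h\<in>{h. a h \<noteq> 0}. \<Sum>k\<in>{k. b k \<noteq> 0}.
                if h \<otimes>\<^bsub>G\<^esub> k = g then a h * b k else 0),
      one = (\<lambda>g. if g = \<one>\<^bsub>G\<^esub> then 1 else 0),
      zero = (\<lambda>g. 0),
      add = (\<lambda>a b g. a g + b g),
      smult = (\<lambda>c a g. c * a g)\<rparr>"

definition group_elem :: "'g \<Rightarrow> 'g \<Rightarrow> 'f::field" where
  "group_elem h = (\<lambda>g. if g = h then 1 else 0)"

definition GL :: "nat \<Rightarrow> 'f::field mat monoid" where
  "GL d = units_of (ring_mat TYPE('f) d ())"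

section \<open>Polynomial functions on the general linear group\<close>

text \<open>
  Matrix entries are indexed by \<open>{..<d}\<close>. Functions on \<open>GL d\<close> are represented by functions on all
  matrices that vanish outside \<open>GL d\<close>.
\<close>

definition entry_fun :: "nat \<Rightarrow> nat \<Rightarrow> nat \<Rightarrow> 'f::field mat \<Rightarrow> 'f" where
  "entry_fun d i j = (\<lambda>g. if g \<in> carrier (GL d) then g $$ (i, j) else 0)"

definition exponents :: "nat \<Rightarrow> nat \<Rightarrow> (nat \<times> nat \<Rightarrow> nat) set" where
  "exponents d r = {m \<in> ({..<d} \<times> {..<d}) \<rightarrow>\<^sub>E UNIV. (\<Sum>p\<in>{..<d} \<times> {..<d}. m p) = r}"

definition monomial_fun :: "nat \<Rightarrow> (nat \<times> nat \<Rightarrow> nat) \<Rightarrow> 'f::field mat \<Rightarrow> 'f" where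
  "monomial_fun d m = (\<lambda>g. if g \<in> carrier (GL d)
     then (\<Prod>(i, j)\<in>{..<d} \<times> {..<d}. entry_fun d i j g ^ m (i, j)) else 0)"

definition homogeneous_funs :: "nat \<Rightarrow> nat \<Rightarrow> ('f::field mat \<Rightarrow> 'f) set" where
  "homogeneous_funs d r = {f. \<exists>a. f = (\<lambda>g. \<Sum>m\<in>exponents d r. a m * monomial_fun d m g)}"

text \<open>
  \<open>coeff_space d n\<close> is the internal sum of the \<open>homogeneous_funs d r\<close> for \<open>r \<le> n\<close>; over an infinite
  field this sum is direct.
\<close>

definition coeff_space :: "nat \<Rightarrow> nat \<Rightarrow> ('f::field mat \<Rightarrow> 'f) set" where
  "coeff_space d n =
     {f. \<exists>h. (\<forall>r\<le>n. h r \<in> homogeneous_funs d r) \<and> f = (\<lambda>g. \<Sum>r\<le>n. h r g)}"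

section \<open>The extended Schur algebra\<close>

definition Maps :: "nat \<Rightarrow> nat set \<Rightarrow> (nat \<Rightarrow> nat) set" where
  "Maps d X = X \<rightarrow>\<^sub>E {..<d}"

definition c_fun :: "nat \<Rightarrow> nat set \<Rightarrow> (nat \<Rightarrow> nat) \<Rightarrow> (nat \<Rightarrow> nat) \<Rightarrow> 'f::field mat \<Rightarrow> 'f" where
  "c_fun d X \<alpha> \<beta> = (\<lambda>g. if g \<in> carrier (GL d)
     then (\<Prod>x\<in>X. entry_fun d (\<alpha> x) (\<beta> x) g) else 0)"

text \<open>Linear functionals on \<open>coeff_space d n\<close>, extended by zero outside of it.\<close>

definition dual_space :: "nat \<Rightarrow> nat \<Rightarrow> (('f::field mat \<Rightarrow> 'f) \<Rightarrow> 'f) set" where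
  "dual_space d n = {\<xi>.
     (\<forall>f\<in>coeff_space d n. \<forall>h\<in>coeff_space d n. \<xi> (\<lambda>g. f g + h g) = \<xi> f + \<xi> h) \<and>
     (\<forall>c. \<forall>f\<in>coeff_space d n. \<xi> (\<lambda>g. c * f g) = c * \<xi> f) \<and>
     (\<forall>f. f \<notin> coeff_space d n \<longrightarrow> \<xi> f = 0)}"

text \<open>
  The functions \<open>c_fun d X \<alpha> \<beta>\<close> with \<open>X \<subseteq> {1..n}\<close> span \<open>coeff_space d n\<close>, so a functional is
  determined by its values on them. The functional \<open>\<zeta>\<close> in \<open>counit\<close> is evaluation at the unit matrix,
  and in \<open>dual_mult\<close> it sends \<open>f\<close> to \<open>\<xi> (\<lambda>g. \<eta> (\<lambda>h. f (g * h)))\<close>, with the inner functions cut off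
  outside \<open>GL d\<close>.
\<close>

definition counit :: "nat \<Rightarrow> nat \<Rightarrow> ('f::field mat \<Rightarrow> 'f) \<Rightarrow> 'f" where
  "counit d n = (THE \<zeta>. \<zeta> \<in> dual_space d n \<and>
     (\<forall>X\<subseteq>{1..n}. \<forall>\<alpha>\<in>Maps d X. \<forall>\<beta>\<in>Maps d X. \<zeta> (c_fun d X \<alpha> \<beta>) = (if \<alpha> = \<beta> then 1 else 0)))"

definition dual_mult :: "nat \<Rightarrow> nat \<Rightarrow> (('f::field mat \<Rightarrow> 'f) \<Rightarrow> 'f)
    \<Rightarrow> (('f mat \<Rightarrow> 'f) \<Rightarrow> 'f) \<Rightarrow> ('f mat \<Rightarrow> 'f) \<Rightarrow> 'f" where
  "dual_mult d n \<xi> \<eta> = (THE \<zeta>. \<zeta> \<in> dual_space d n \<and>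
     (\<forall>X\<subseteq>{1..n}. \<forall>\<alpha>\<in>Maps d X. \<forall>\<beta>\<in>Maps d X.
        \<zeta> (c_fun d X \<alpha> \<beta>) = (\<Sum>\<gamma>\<in>Maps d X. \<xi> (c_fun d X \<alpha> \<gamma>) * \<eta> (c_fun d X \<gamma> \<beta>))))"

definition extended_schur_algebra ::
  "nat \<Rightarrow> nat \<Rightarrow> ('f::field, ('f mat \<Rightarrow> 'f) \<Rightarrow> 'f) module" where
  "extended_schur_algebra d n =
     \<lparr>carrier = dual_space d n,
      mult = dual_mult d n,
      one = counit d n,
      zero = (\<lambda>f. 0),
      add = (\<lambda>\<xi> \<eta> f. \<xi> f + \<eta> f),
      smult = (\<lambda>c \<xi> f. c * \<xi> f)\<rparr>"

section \<open>Modules with coefficient functions in a given space\<close>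

text \<open>
  The family \<open>\<phi>\<close> consists of the coefficient functions of the module \<open>M\<close> with respect to the
  basis \<open>B\<close>, indexed by the basis vectors themselves.
\<close>

definition coefficient_functions :: "nat \<Rightarrow> ('f::field mat \<Rightarrow> 'f, 'v) module \<Rightarrow> 'v set
    \<Rightarrow> ('v \<Rightarrow> 'v \<Rightarrow> 'f mat \<Rightarrow> 'f) \<Rightarrow> bool" where
  "coefficient_functions d M B \<phi> \<longleftrightarrow>
     (\<forall>a\<in>B. \<forall>b\<in>B. \<forall>g. g \<notin> carrier (GL d) \<longrightarrow> \<phi> a b g = 0) \<and>
     (\<forall>g\<in>carrier (GL d). \<forall>b\<in>B.
        group_elem g \<odot>\<^bsub>M\<^esub> b
        = module.lincomb (underlying_space (group_algebra (GL d)) M) (\<lambda>a. \<phi> a b g) B)"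

text \<open>The condition below does not depend on the choice of the basis.\<close>

definition coefficients_in :: "nat \<Rightarrow> ('f::field mat \<Rightarrow> 'f) set
    \<Rightarrow> ('f mat \<Rightarrow> 'f, 'v) module \<Rightarrow> bool" where
  "coefficients_in d S M \<longleftrightarrow> (\<exists>B \<phi>.
     finite B \<and>
     vectorspace.basis (class_ring :: 'f ring) (underlying_space (group_algebra (GL d)) M) B \<and>
     coefficient_functions d M B \<phi> \<and> (\<forall>a\<in>B. \<forall>b\<in>B. \<phi> a b \<in> S))"

end

theory Submission
  imports Defs
begin

text \<open>
  Let \<open>S\<close> be the extended Schur algebra. An element \<open>a\<close> of the group algebra of \<open>GL d\<close> defines the
  functional \<open>f \<mapsto> (\<Sum>g. a g * f g)\<close> on \<open>coeff_space d n\<close>, and this is an algebra homomorphism \<open>\<pi>\<close> to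
  \<open>S\<close>. It is surjective, because \<open>coeff_space d n\<close> is a finite-dimensional space of functions, whose
  functionals are all combinations of evaluations. So \<open>S\<close>-modules are the same as modules over the
  group algebra on which the kernel of \<open>\<pi>\<close> acts as zero. The kernel consists of the \<open>a\<close> with
  \<open>(\<Sum>g. a g * f g) = 0\<close> for all \<open>f\<close> in \<open>coeff_space d n\<close>, so it kills every module with coefficient
  functions in this space. Conversely, if the kernel acts as zero and \<open>u i\<close> are elements dual to a
  basis of functions \<open>i\<close> of \<open>coeff_space d n\<close>, then every \<open>g\<close> acts as \<open>\<Sum>i. i g * u i\<close>, whose
  matrix entries are combinations of the functions \<open>i\<close>.
\<close>

section \<open>Modules over an algebra\<close>

context assoc_algebra
begin

sublocale R: ring A
  by (rule ring)

sublocale V: vectorspace "class_ring :: 'f ring" A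
  by (rule vectorspace)

lemma scalar_closed [simp]: "c \<odot>\<^bsub>A\<^esub> \<one>\<^bsub>A\<^esub> \<in> carrier A"
  by simp

lemma scalar_mult_left: "a \<in> carrier A \<Longrightarrow> (c \<odot>\<^bsub>A\<^esub> \<one>\<^bsub>A\<^esub>) \<otimes>\<^bsub>A\<^esub> a = c \<odot>\<^bsub>A\<^esub> a"
  by (simp add: smult_mult_left)

lemma scalar_mult_right: "a \<in> carrier A \<Longrightarrow> a \<otimes>\<^bsub>A\<^esub> (c \<odot>\<^bsub>A\<^esub> \<one>\<^bsub>A\<^esub>) = c \<odot>\<^bsub>A\<^esub> a"
  by (simp add: smult_mult_right)

end

lemma underlying_space_simps [simp]:
  "carrier (underlying_space A M) = carrier M"
  "zero (underlying_space A M) = zero M"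
  "add (underlying_space A M) = add M"
  "smult (underlying_space A M) = (\<lambda>c v. (c \<odot>\<^bsub>A\<^esub> \<one>\<^bsub>A\<^esub>) \<odot>\<^bsub>M\<^esub> v)"
  by (simp_all add: underlying_space_def)

context left_module
begin

lemma act_smult:
  assumes "a \<in> carrier A" "v \<in> carrier M"
  shows "(c \<odot>\<^bsub>A\<^esub> a) \<odot>\<^bsub>M\<^esub> v = (c \<odot>\<^bsub>A\<^esub> \<one>\<^bsub>A\<^esub>) \<odot>\<^bsub>M\<^esub> (a \<odot>\<^bsub>M\<^esub> v)"
  using assms act_mult[of "c \<odot>\<^bsub>A\<^esub> \<one>\<^bsub>A\<^esub>" a v] by (simp add: scalar_mult_left)

text \<open>Multiples of the unit are central in \<open>A\<close>, so every element of
  \<open>A\<close> acts linearly over the field.\<close>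

lemma act_scalar:
  assumes "a \<in> carrier A" "v \<in> carrier M"
  shows "a \<odot>\<^bsub>M\<^esub> ((c \<odot>\<^bsub>A\<^esub> \<one>\<^bsub>A\<^esub>) \<odot>\<^bsub>M\<^esub> v) = (c \<odot>\<^bsub>A\<^esub> \<one>\<^bsub>A\<^esub>) \<odot>\<^bsub>M\<^esub> (a \<odot>\<^bsub>M\<^esub> v)"
proof -
  have "a \<odot>\<^bsub>M\<^esub> ((c \<odot>\<^bsub>A\<^esub> \<one>\<^bsub>A\<^esub>) \<odot>\<^bsub>M\<^esub> v) = (a \<otimes>\<^bsub>A\<^esub> (c \<odot>\<^bsub>A\<^esub> \<one>\<^bsub>A\<^esub>)) \<odot>\<^bsub>M\<^esub> v"
    using assms act_mult[of a "c \<odot>\<^bsub>A\<^esub> \<one>\<^bsub>A\<^esub>" v] by simp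
  then show ?thesis
    using assms by (simp add: scalar_mult_right act_smult)
qed

text \<open>Sending \<open>c\<close> to \<open>c\<close> times the unit is a ring homomorphism from
  the field to \<open>A\<close>, so the module axioms over \<open>A\<close> restrict to those of a
  vector space.\<close>

lemma underlying_space_vectorspace:
  "vectorspace (class_ring :: 'f ring) (underlying_space A M)"
proof (rule vs_criteria)
  show "field (class_ring :: 'f ring)"
    by (rule class_field)
  show "\<forall>v\<in>carrier (underlying_space A M). \<exists>w\<in>carrier (underlying_space A M).
      v \<oplus>\<^bsub>underlying_space A M\<^esub> w = \<zero>\<^bsub>underlying_space A M\<^esub>"
    using local.r_neg a_inv_closed by fastforce
  show "\<forall>a b v. a \<in> carrier class_ring \<and> b \<in> carrier class_ring \<and> v \<in> carrier (underlying_space A M) \<longrightarrow>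
      (a \<otimes>\<^bsub>class_ring\<^esub> b) \<odot>\<^bsub>underlying_space A M\<^esub> v =
      a \<odot>\<^bsub>underlying_space A M\<^esub> (b \<odot>\<^bsub>underlying_space A M\<^esub> v)"
  proof clarsimp
    fix a b v assume v: "v \<in> carrier M"
    have "((a * b) \<odot>\<^bsub>A\<^esub> \<one>\<^bsub>A\<^esub>) = a \<odot>\<^bsub>A\<^esub> (b \<odot>\<^bsub>A\<^esub> \<one>\<^bsub>A\<^esub>)"
      using V.smult_assoc1[of a b "\<one>\<^bsub>A\<^esub>"] by simp
    then show "((a * b) \<odot>\<^bsub>A\<^esub> \<one>\<^bsub>A\<^esub>) \<odot>\<^bsub>M\<^esub> v = (a \<odot>\<^bsub>A\<^esub> \<one>\<^bsub>A\<^esub>) \<odot>\<^bsub>M\<^esub> ((b \<odot>\<^bsub>A\<^esub> \<one>\<^bsub>A\<^esub>) \<odot>\<^bsub>M\<^esub> v)"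
      using v act_smult[of "b \<odot>\<^bsub>A\<^esub> \<one>\<^bsub>A\<^esub>" v a] by simp
  qed
  show "\<forall>a b v. a \<in> carrier class_ring \<and> b \<in> carrier class_ring \<and> v \<in> carrier (underlying_space A M) \<longrightarrow>
      (a \<oplus>\<^bsub>class_ring\<^esub> b) \<odot>\<^bsub>underlying_space A M\<^esub> v =
      a \<odot>\<^bsub>underlying_space A M\<^esub> v \<oplus>\<^bsub>underlying_space A M\<^esub> b \<odot>\<^bsub>underlying_space A M\<^esub> v"
  proof clarsimp
    fix a b v assume v: "v \<in> carrier M"
    have "((a + b) \<odot>\<^bsub>A\<^esub> \<one>\<^bsub>A\<^esub>) = (a \<odot>\<^bsub>A\<^esub> \<one>\<^bsub>A\<^esub>) \<oplus>\<^bsub>A\<^esub> (b \<odot>\<^bsub>A\<^esub> \<one>\<^bsub>A\<^esub>)"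
      using V.smult_l_distr[of a b "\<one>\<^bsub>A\<^esub>"] by simp
    then show "((a + b) \<odot>\<^bsub>A\<^esub> \<one>\<^bsub>A\<^esub>) \<odot>\<^bsub>M\<^esub> v
        = (a \<odot>\<^bsub>A\<^esub> \<one>\<^bsub>A\<^esub>) \<odot>\<^bsub>M\<^esub> v \<oplus>\<^bsub>M\<^esub> (b \<odot>\<^bsub>A\<^esub> \<one>\<^bsub>A\<^esub>) \<odot>\<^bsub>M\<^esub> v"
      using v by (simp add: act_add_left)
  qed
  show "\<forall>v\<in>carrier (underlying_space A M).
      \<one>\<^bsub>class_ring\<^esub> \<odot>\<^bsub>underlying_space A M\<^esub> v = v"
    using act_one V.smult_one[of "\<one>\<^bsub>A\<^esub>"] by simp
qed (auto simp: act_closed act_add_right a_ac)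

sublocale U: vectorspace "class_ring :: 'f ring" "underlying_space A M"
  by (rule underlying_space_vectorspace)

lemma act_linear_map:
  assumes "a \<in> carrier A"
  shows "linear_map (class_ring :: 'f ring) (underlying_space A M) (underlying_space A M) (smult M a)"
  unfolding linear_map_def mod_hom_def mod_hom_axioms_def LinearCombinations.module_hom_def
  using underlying_space_vectorspace U.module_axioms assms
  by (auto simp: act_closed act_add_right act_scalar)

lemma act_zero:
  assumes "v \<in> carrier M"
  shows "\<zero>\<^bsub>A\<^esub> \<odot>\<^bsub>M\<^esub> v = \<zero>\<^bsub>M\<^esub>"
  using act_add_left[of "\<zero>\<^bsub>A\<^esub>" "\<zero>\<^bsub>A\<^esub>" v] assms act_closed[of "\<zero>\<^bsub>A\<^esub>" v] by simp

text \<open>The kernel of the linear map given by \<open>a\<close> is a subspace; containing the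
  basis, it contains its span.\<close>

lemma act_eq_zero_if_basis:
  assumes a: "a \<in> carrier A" and B: "vectorspace.basis (class_ring :: 'f ring) (underlying_space A M) B"
    and 0: "\<And>b. b \<in> B \<Longrightarrow> a \<odot>\<^bsub>M\<^esub> b = \<zero>\<^bsub>M\<^esub>" and v: "v \<in> carrier M"
  shows "a \<odot>\<^bsub>M\<^esub> v = \<zero>\<^bsub>M\<^esub>"
proof -
  interpret T: linear_map "class_ring :: 'f ring" "underlying_space A M" "underlying_space A M" "smult M a"
    by (rule act_linear_map[OF a])
  have "B \<subseteq> T.ker"
    using 0 B unfolding T.ker_def U.basis_def by auto
  then have "U.span B \<subseteq> T.ker"
    by (rule U.span_is_subset[OF _ T.ker_is_submodule])
  then show ?thesis
    using v B unfolding T.ker_def U.basis_def by auto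
qed

lemma lincomb_zero:
  assumes "B \<subseteq> carrier M"
  shows "module.lincomb (underlying_space A M) (\<lambda>b. 0) B = \<zero>\<^bsub>M\<^esub>"
proof -
  \<comment> \<open>Scaling by 0 leaves the zero coefficients unchanged, so the combination is 0
    times itself.\<close>
  have "U.lincomb (\<lambda>b. 0) B = 0 \<odot>\<^bsub>underlying_space A M\<^esub> U.lincomb (\<lambda>b. 0) B"
    using U.lincomb_smult[of B "\<lambda>b. 0" 0] assms by simp
  then show ?thesis
    using U.lmult_0[of "U.lincomb (\<lambda>b. 0) B"] U.lincomb_closed[of B "\<lambda>b. 0"] assms
    by simp
qed

text \<open>Coordinates of a linear combination of algebra elements applied to a vector. Both
  directions of the coefficient criterion use this: once with group elements as \<open>x i\<close>,
  once with elements dual to a basis of functions.\<close>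

lemma act_finsum_lincomb:
  fixes x :: "'i \<Rightarrow> 'a"
  assumes "finite I" "\<And>i. i \<in> I \<Longrightarrow> x i \<in> carrier A" "finite B" "B \<subseteq> carrier M" "v \<in> carrier M"
    "\<And>i. i \<in> I \<Longrightarrow> x i \<odot>\<^bsub>M\<^esub> v = module.lincomb (underlying_space A M) (\<chi> i) B"
  shows "(\<Oplus>\<^bsub>A\<^esub>i\<in>I. t i \<odot>\<^bsub>A\<^esub> x i) \<odot>\<^bsub>M\<^esub> v
    = module.lincomb (underlying_space A M) (\<lambda>b. \<Sum>i\<in>I. t i * \<chi> i b) B"
  using assms
proof (induction I rule: finite_induct)
  case empty
  then show ?case
    by (simp add: act_zero lincomb_zero)
next
  case (insert j I)
  let ?U = "underlying_space A M"
  have fc: "finsum A (\<lambda>i. t i \<odot>\<^bsub>A\<^esub> x i) I \<in> carrier A"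
    using insert by (auto intro!: R.finsum_closed)
  have "(\<Oplus>\<^bsub>A\<^esub>i\<in>insert j I. t i \<odot>\<^bsub>A\<^esub> x i) \<odot>\<^bsub>M\<^esub> v
      = (t j \<odot>\<^bsub>A\<^esub> x j \<oplus>\<^bsub>A\<^esub> (\<Oplus>\<^bsub>A\<^esub>i\<in>I. t i \<odot>\<^bsub>A\<^esub> x i)) \<odot>\<^bsub>M\<^esub> v"
    by (subst R.finsum_insert) (use insert in auto)
  also have "\<dots> = (t j \<odot>\<^bsub>A\<^esub> x j) \<odot>\<^bsub>M\<^esub> v \<oplus>\<^bsub>M\<^esub> (\<Oplus>\<^bsub>A\<^esub>i\<in>I. t i \<odot>\<^bsub>A\<^esub> x i) \<odot>\<^bsub>M\<^esub> v"
    using insert fc by (subst act_add_left) auto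
  also have "(t j \<odot>\<^bsub>A\<^esub> x j) \<odot>\<^bsub>M\<^esub> v = t j \<odot>\<^bsub>?U\<^esub> U.lincomb (\<chi> j) B"
    using insert by (subst act_smult) auto
  also have "\<dots> = U.lincomb (\<lambda>b. t j * \<chi> j b) B"
    using U.lincomb_smult[of B "\<chi> j" "t j"] insert by simp
  also have "(\<Oplus>\<^bsub>A\<^esub>i\<in>I. t i \<odot>\<^bsub>A\<^esub> x i) \<odot>\<^bsub>M\<^esub> v = U.lincomb (\<lambda>b. \<Sum>i\<in>I. t i * \<chi> i b) B"
    by (rule insert.IH) (use insert in auto)
  also have "U.lincomb (\<lambda>b. t j * \<chi> j b) B \<oplus>\<^bsub>M\<^esub> U.lincomb (\<lambda>b. \<Sum>i\<in>I. t i * \<chi> i b) B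
      = U.lincomb (\<lambda>b. t j * \<chi> j b + (\<Sum>i\<in>I. t i * \<chi> i b)) B"
    using U.lincomb_sum[of B "\<lambda>b. t j * \<chi> j b" "\<lambda>b. \<Sum>i\<in>I. t i * \<chi> i b"] insert by simp
  finally show ?case
    using insert by simp
qed

end

text \<open>When an action is changed along a section of \<pi>, scalars may act differently on
  vectors outside the carrier, so the underlying spaces need not be equal records. Finite dimension
  depends only on the operations on the carrier.\<close>

lemma fin_dim_cong:
  fixes U W :: "('f::field, 'v) module"
  assumes U: "vectorspace (class_ring :: 'f ring) U" and W: "vectorspace (class_ring :: 'f ring) W"
    and eq: "carrier U = carrier W" "zero U = zero W" "add U = add W"
    and smult: "\<And>c v. v \<in> carrier W \<Longrightarrow> c \<odot>\<^bsub>U\<^esub> v = c \<odot>\<^bsub>W\<^esub> v"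
    and fin: "vectorspace.fin_dim (class_ring :: 'f ring) U"
  shows "vectorspace.fin_dim (class_ring :: 'f ring) W"
proof -
  interpret U: vectorspace "class_ring :: 'f ring" U by (rule U)
  interpret W: vectorspace "class_ring :: 'f ring" W by (rule W)
  obtain S where S: "finite S" "S \<subseteq> carrier U" "U.span S = carrier U"
    using fin unfolding U.fin_dim_def by auto
  \<comment> \<open>\<open>finsum\<close> refers only to carrier, zero and addition, so it is the
    same in both spaces; the scalar multiplications are then compared on carrier vectors.\<close>
  have lc: "U.lincomb a T = W.lincomb a T" if "T \<subseteq> carrier W" for a T
  proof -
    have "U.lincomb a T = (\<Oplus>\<^bsub>W\<^esub>v\<in>T. a v \<odot>\<^bsub>U\<^esub> v)"
      unfolding U.lincomb_def finsum_def using eq by simp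
    also have "\<dots> = W.lincomb a T"
      unfolding W.lincomb_def using that by (intro W.finsum_cong') (auto simp: smult)
    finally show ?thesis .
  qed
  have "W.span S = carrier W"
    using S lc eq U.finite_span[of S] W.finite_span[of S] by auto
  then show ?thesis
    using S eq unfolding W.fin_dim_def by auto
qed

section \<open>Categories of modules\<close>

lemma fd_module_category_simps [simp]:
  "Obj (fd_module_category A) = {M. fd_left_module A M}"
  "Hom (fd_module_category A) = (\<lambda>M N. LinearCombinations.module_hom A M N \<inter> extensional (carrier M))"
  "Ident (fd_module_category A) = (\<lambda>M. \<lambda>v\<in>carrier M. v)"
  "Comp (fd_module_category A) = (\<lambda>L M N g f. compose (carrier L) g f)"
  by (simp_all add: fd_module_category_def)

lemma full_subcategory_simps [simp]:
  "Obj (full_subcategory C P) = {X \<in> Obj C. P X}"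
  "Hom (full_subcategory C P) = Hom C"
  "Ident (full_subcategory C P) = Ident C"
  "Comp (full_subcategory C P) = Comp C"
  by (simp_all add: full_subcategory_def)

lemma category_fd_module_category: "category (fd_module_category A)"
proof
  fix M assume "M \<in> Obj (fd_module_category A)"
  then interpret left_module A M by (simp add: fd_left_module_def)
  show "Ident (fd_module_category A) M \<in> Hom (fd_module_category A) M M"
    by (auto simp: LinearCombinations.module_hom_def act_closed)
next
  fix L M N f g
  assume "L \<in> Obj (fd_module_category A)" "f \<in> Hom (fd_module_category A) L M"
    "g \<in> Hom (fd_module_category A) M N"
  then interpret left_module A L by (simp add: fd_left_module_def)
  show "Comp (fd_module_category A) L M N g f \<in> Hom (fd_module_category A) L N"
    using \<open>f \<in> _\<close> \<open>g \<in> _\<close>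
    by (auto simp: LinearCombinations.module_hom_def act_closed compose_def extensional_def Pi_iff)
next
  fix M N f assume f: "f \<in> Hom (fd_module_category A) M N"
  then show "Comp (fd_module_category A) M M N f (Ident (fd_module_category A) M) = f"
    by (auto intro!: compose_Id simp: LinearCombinations.module_hom_def)
  show "Comp (fd_module_category A) M N N (Ident (fd_module_category A) N) f = f"
    using f by (auto intro!: Id_compose simp: LinearCombinations.module_hom_def)
next
  fix K L M N f g h
  assume "f \<in> Hom (fd_module_category A) K L"
  then show "Comp (fd_module_category A) K M N h (Comp (fd_module_category A) K L M g f)
      = Comp (fd_module_category A) K L N (Comp (fd_module_category A) L M N h g) f"
    by (auto simp: LinearCombinations.module_hom_def compose_def fun_eq_iff Pi_iff)
qed

lemma category_full_subcategory: "category C \<Longrightarrow> category (full_subcategory C P)"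
  unfolding category_def by simp

text \<open>Changing the action to and fro returns a record that may differ from the original
  outside the carriers. The identity function is still an isomorphism, and it serves for both
  natural isomorphisms of the equivalence.\<close>

lemma cat_iso_identity:
  assumes "left_module A M" "carrier N = carrier M" "add N = add M"
    and "\<And>a v. a \<in> carrier A \<Longrightarrow> v \<in> carrier M \<Longrightarrow> a \<odot>\<^bsub>N\<^esub> v = a \<odot>\<^bsub>M\<^esub> v"
  shows "cat_iso (fd_module_category A) N M (\<lambda>v\<in>carrier M. v)"
proof -
  interpret left_module A M by fact
  show ?thesis
    unfolding cat_iso_def using assms(2-)
    by (auto intro!: bexI[of _ "\<lambda>v\<in>carrier M. v"]
      simp: LinearCombinations.module_hom_def act_closed compose_def fun_eq_iff)
qed

section \<open>Modules along a surjective algebra homomorphism\<close>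

text \<open>\<open>f\<close> is any function, because the action is changed along the homomorphism
  \<pi> in one direction and along a mere section of it in the other.\<close>

definition change_action :: "('a \<Rightarrow> 'b) \<Rightarrow> ('b, 'v) module \<Rightarrow> ('a, 'v) module" where
  "change_action f M = \<lparr>carrier = carrier M, mult = mult M, one = one M, zero = zero M,
     add = add M, smult = (\<lambda>a v. f a \<odot>\<^bsub>M\<^esub> v)\<rparr>"

lemma change_action_simps [simp]:
  "carrier (change_action f M) = carrier M"
  "zero (change_action f M) = zero M"
  "add (change_action f M) = add M"
  "smult (change_action f M) = (\<lambda>a v. f a \<odot>\<^bsub>M\<^esub> v)"
  by (simp_all add: change_action_def)

lemma abelian_group_change_action:
  assumes "abelian_group M"
  shows "abelian_group (change_action f M)"
proof -
  interpret abelian_group M by fact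
  show ?thesis
    by (rule abelian_groupI) (auto simp: a_ac intro: bexI[of _ "\<ominus>\<^bsub>M\<^esub> _"] l_neg)
qed

text \<open>The laws of \<open>B\<close> are to be deduced from those of \<open>A\<close>, so the
  assumptions only relate the operations through \<pi>. \<open>hom_zero\<close> is listed because it
  follows from additivity only once \<open>B\<close> is known to be a group.\<close>

locale algebra_surjection = A: assoc_algebra A
  for A :: "('f::field, 'a) module" and B :: "('f, 'b) module" and \<pi> :: "'a \<Rightarrow> 'b" +
  assumes surj: "\<pi> ` carrier A = carrier B"
    and hom_add: "\<lbrakk>x \<in> carrier A; y \<in> carrier A\<rbrakk> \<Longrightarrow> \<pi> (x \<oplus>\<^bsub>A\<^esub> y) = \<pi> x \<oplus>\<^bsub>B\<^esub> \<pi> y"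
    and hom_mult: "\<lbrakk>x \<in> carrier A; y \<in> carrier A\<rbrakk> \<Longrightarrow> \<pi> (x \<otimes>\<^bsub>A\<^esub> y) = \<pi> x \<otimes>\<^bsub>B\<^esub> \<pi> y"
    and hom_smult: "x \<in> carrier A \<Longrightarrow> \<pi> (c \<odot>\<^bsub>A\<^esub> x) = c \<odot>\<^bsub>B\<^esub> \<pi> x"
    and hom_one: "\<pi> \<one>\<^bsub>A\<^esub> = \<one>\<^bsub>B\<^esub>"
    and hom_zero: "\<pi> \<zero>\<^bsub>A\<^esub> = \<zero>\<^bsub>B\<^esub>"
begin

lemma hom_closed [simp]: "x \<in> carrier A \<Longrightarrow> \<pi> x \<in> carrier B"
  using surj by blast

text \<open>By surjectivity every element of \<open>B\<close> is some \<open>\<pi> a\<close>, so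
  each law of \<open>B\<close> is the image of the same law of \<open>A\<close>. This is how the
  extended Schur algebra is seen to be an algebra.\<close>

lemma assoc_algebra_image: "assoc_algebra B"
proof -
  have add: "abelian_group B"
  proof (rule abelian_groupI)
    show "\<And>x y. x \<in> carrier B \<Longrightarrow> y \<in> carrier B \<Longrightarrow> x \<oplus>\<^bsub>B\<^esub> y \<in> carrier B"
      unfolding surj[symmetric] by (auto simp flip: hom_add)
    show "\<zero>\<^bsub>B\<^esub> \<in> carrier B"
      by (simp flip: hom_zero)
    show "\<And>x y z. x \<in> carrier B \<Longrightarrow> y \<in> carrier B \<Longrightarrow> z \<in> carrier B
        \<Longrightarrow> x \<oplus>\<^bsub>B\<^esub> y \<oplus>\<^bsub>B\<^esub> z = x \<oplus>\<^bsub>B\<^esub> (y \<oplus>\<^bsub>B\<^esub> z)"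
      unfolding surj[symmetric] by (auto simp: A.R.a_assoc simp flip: hom_add)
    show "\<And>x y. x \<in> carrier B \<Longrightarrow> y \<in> carrier B \<Longrightarrow> x \<oplus>\<^bsub>B\<^esub> y = y \<oplus>\<^bsub>B\<^esub> x"
      unfolding surj[symmetric] by (auto simp: A.R.a_comm simp flip: hom_add)
    show "\<And>x. x \<in> carrier B \<Longrightarrow> \<zero>\<^bsub>B\<^esub> \<oplus>\<^bsub>B\<^esub> x = x"
      unfolding surj[symmetric] by (auto simp flip: hom_add hom_zero)
    fix x assume "x \<in> carrier B"
    then obtain a where a: "a \<in> carrier A" "x = \<pi> a"
      unfolding surj[symmetric] by auto
    then have "\<pi> (\<ominus>\<^bsub>A\<^esub> a) \<oplus>\<^bsub>B\<^esub> x = \<zero>\<^bsub>B\<^esub>"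
      by (simp add: A.R.l_neg flip: hom_add hom_zero)
    then show "\<exists>y\<in>carrier B. y \<oplus>\<^bsub>B\<^esub> x = \<zero>\<^bsub>B\<^esub>"
      using a by (intro bexI[of _ "\<pi> (\<ominus>\<^bsub>A\<^esub> a)"]) auto
  qed
  have mult: "monoid B"
  proof (rule monoidI)
    show "\<And>x y. x \<in> carrier B \<Longrightarrow> y \<in> carrier B \<Longrightarrow> x \<otimes>\<^bsub>B\<^esub> y \<in> carrier B"
      unfolding surj[symmetric] by (auto simp flip: hom_mult)
    show "\<one>\<^bsub>B\<^esub> \<in> carrier B"
      by (simp flip: hom_one)
    show "\<And>x y z. x \<in> carrier B \<Longrightarrow> y \<in> carrier B \<Longrightarrow> z \<in> carrier B
        \<Longrightarrow> x \<otimes>\<^bsub>B\<^esub> y \<otimes>\<^bsub>B\<^esub> z = x \<otimes>\<^bsub>B\<^esub> (y \<otimes>\<^bsub>B\<^esub> z)"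
      unfolding surj[symmetric] by (auto simp: A.R.m_assoc simp flip: hom_mult)
    show "\<And>x. x \<in> carrier B \<Longrightarrow> \<one>\<^bsub>B\<^esub> \<otimes>\<^bsub>B\<^esub> x = x" "\<And>x. x \<in> carrier B \<Longrightarrow> x \<otimes>\<^bsub>B\<^esub> \<one>\<^bsub>B\<^esub> = x"
      unfolding surj[symmetric] by (auto simp flip: hom_mult hom_one)
  qed
  interpret B: abelian_group B by (rule add)
  have ring: "ring B"
  proof (rule ringI[OF add mult])
    show "\<And>x y z. x \<in> carrier B \<Longrightarrow> y \<in> carrier B \<Longrightarrow> z \<in> carrier B
        \<Longrightarrow> (x \<oplus>\<^bsub>B\<^esub> y) \<otimes>\<^bsub>B\<^esub> z = x \<otimes>\<^bsub>B\<^esub> z \<oplus>\<^bsub>B\<^esub> y \<otimes>\<^bsub>B\<^esub> z"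
      unfolding surj[symmetric] by (auto simp: A.R.l_distr simp flip: hom_mult hom_add)
    show "\<And>x y z. x \<in> carrier B \<Longrightarrow> y \<in> carrier B \<Longrightarrow> z \<in> carrier B
        \<Longrightarrow> z \<otimes>\<^bsub>B\<^esub> (x \<oplus>\<^bsub>B\<^esub> y) = z \<otimes>\<^bsub>B\<^esub> x \<oplus>\<^bsub>B\<^esub> z \<otimes>\<^bsub>B\<^esub> y"
      unfolding surj[symmetric] by (auto simp: A.R.r_distr simp flip: hom_mult hom_add)
  qed
  have smult: "module (class_ring :: 'f ring) B"
  proof (rule Module.module.intro)
    show "cring (class_ring :: 'f ring)" by unfold_locales
    show "abelian_group B" by (rule add)
    show "module_axioms (class_ring :: 'f ring) B"
    proof
      fix a b :: 'f and x y
      show "x \<in> carrier B \<Longrightarrow> a \<odot>\<^bsub>B\<^esub> x \<in> carrier B"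
        unfolding surj[symmetric] by (auto simp flip: hom_smult)
      show "x \<in> carrier B \<Longrightarrow> (a \<oplus>\<^bsub>class_ring\<^esub> b) \<odot>\<^bsub>B\<^esub> x = a \<odot>\<^bsub>B\<^esub> x \<oplus>\<^bsub>B\<^esub> b \<odot>\<^bsub>B\<^esub> x"
        unfolding surj[symmetric] using A.V.smult_l_distr
        by (auto simp flip: hom_smult hom_add)
      show "x \<in> carrier B \<Longrightarrow> y \<in> carrier B \<Longrightarrow> a \<odot>\<^bsub>B\<^esub> (x \<oplus>\<^bsub>B\<^esub> y) = a \<odot>\<^bsub>B\<^esub> x \<oplus>\<^bsub>B\<^esub> a \<odot>\<^bsub>B\<^esub> y"
        unfolding surj[symmetric] using A.V.smult_r_distr
        by (auto simp flip: hom_smult hom_add)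
      show "x \<in> carrier B \<Longrightarrow> (a \<otimes>\<^bsub>class_ring\<^esub> b) \<odot>\<^bsub>B\<^esub> x = a \<odot>\<^bsub>B\<^esub> (b \<odot>\<^bsub>B\<^esub> x)"
        unfolding surj[symmetric] using A.V.smult_assoc1
        by (auto simp flip: hom_smult)
      show "x \<in> carrier B \<Longrightarrow> \<one>\<^bsub>class_ring\<^esub> \<odot>\<^bsub>B\<^esub> x = x"
        unfolding surj[symmetric] using A.V.smult_one
        by (auto simp flip: hom_smult)
    qed
  qed
  show ?thesis
  proof (rule assoc_algebra.intro)
    show "vectorspace (class_ring :: 'f ring) B"
      using smult class_field by (simp add: vectorspace_def)
    show "ring B" by (rule ring)
    show "\<And>x y c. x \<in> carrier B \<Longrightarrow> y \<in> carrier B \<Longrightarrow> (c \<odot>\<^bsub>B\<^esub> x) \<otimes>\<^bsub>B\<^esub> y = c \<odot>\<^bsub>B\<^esub> (x \<otimes>\<^bsub>B\<^esub> y)"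
      unfolding surj[symmetric] by (auto simp: A.smult_mult_left simp flip: hom_smult hom_mult)
    show "\<And>x y c. x \<in> carrier B \<Longrightarrow> y \<in> carrier B \<Longrightarrow> x \<otimes>\<^bsub>B\<^esub> (c \<odot>\<^bsub>B\<^esub> y) = c \<odot>\<^bsub>B\<^esub> (x \<otimes>\<^bsub>B\<^esub> y)"
      unfolding surj[symmetric] by (auto simp: A.smult_mult_right simp flip: hom_smult hom_mult)
  qed
qed

sublocale B: assoc_algebra B
  by (rule assoc_algebra_image)

definition kernel_annihilates :: "('a, 'v) module \<Rightarrow> bool" where
  "kernel_annihilates M \<longleftrightarrow>
     (\<forall>a\<in>carrier A. \<pi> a = \<zero>\<^bsub>B\<^esub> \<longrightarrow> (\<forall>v\<in>carrier M. a \<odot>\<^bsub>M\<^esub> v = \<zero>\<^bsub>M\<^esub>))"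

text \<open>An arbitrary choice of preimages, in general not a homomorphism.\<close>

definition lift :: "'b \<Rightarrow> 'a" where
  "lift = inv_into (carrier A) \<pi>"

lemma lift_closed [simp]: "b \<in> carrier B \<Longrightarrow> lift b \<in> carrier A"
  unfolding lift_def surj[symmetric] by (rule inv_into_into)

lemma hom_lift [simp]: "b \<in> carrier B \<Longrightarrow> \<pi> (lift b) = b"
  unfolding lift_def surj[symmetric] by (rule f_inv_into_f)

text \<open>\<open>x - y\<close> lies in the kernel of \<pi>. Preimages may therefore be exchanged
  freely, which makes the choice in \<open>lift\<close> harmless.\<close>

lemma act_cong:
  assumes "left_module A M" "kernel_annihilates M"
    and x: "x \<in> carrier A" "y \<in> carrier A" "\<pi> x = \<pi> y" and v: "v \<in> carrier M"
  shows "x \<odot>\<^bsub>M\<^esub> v = y \<odot>\<^bsub>M\<^esub> v"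
proof -
  interpret left_module A M by fact
  let ?z = "x \<oplus>\<^bsub>A\<^esub> \<ominus>\<^bsub>A\<^esub> y"
  have z: "?z \<in> carrier A" using x by simp
  \<comment> \<open>Since \<open>\<pi> x = \<pi> y\<close>, additivity allows \<open>x\<close> to be
    replaced by \<open>y\<close>, which leaves \<pi> at zero without a rule for negatives.\<close>
  have "\<pi> ?z = \<pi> (y \<oplus>\<^bsub>A\<^esub> \<ominus>\<^bsub>A\<^esub> y)"
    using x by (simp add: hom_add del: A.R.r_neg)
  then have "\<pi> ?z = \<zero>\<^bsub>B\<^esub>"
    using x by (simp add: hom_zero A.R.r_neg)
  then have 0: "?z \<odot>\<^bsub>M\<^esub> v = \<zero>\<^bsub>M\<^esub>"
    using assms(2) v z unfolding kernel_annihilates_def by blast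
  have "x = ?z \<oplus>\<^bsub>A\<^esub> y"
    using x by (simp add: A.R.a_assoc A.R.l_neg)
  then have "x \<odot>\<^bsub>M\<^esub> v = ?z \<odot>\<^bsub>M\<^esub> v \<oplus>\<^bsub>M\<^esub> y \<odot>\<^bsub>M\<^esub> v"
    using act_add_left[OF z x(2) v] by simp
  then show ?thesis
    using 0 x v by (simp add: act_closed)
qed

section \<open>Pulling modules back along the surjection and descending them\<close>

lemma fd_left_module_pullback:
  assumes "fd_left_module B N"
  shows "fd_left_module A (change_action \<pi> N)"
proof -
  interpret N: left_module B N
    using assms by (simp add: fd_left_module_def)
  have "left_module A (change_action \<pi> N)"
  proof (intro left_module.intro left_module_axioms.intro abelian_group_change_action)
    show "assoc_algebra A" "abelian_group N" by unfold_locales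
  qed (auto simp: N.act_closed N.act_add_left N.act_add_right N.act_mult N.act_one
      hom_add hom_mult hom_one)
  \<comment> \<open>\<pi> maps \<open>c\<close> times the unit of \<open>A\<close> to
    \<open>c\<close> times the unit of \<open>B\<close>, so the two scalar actions are the same
    function on all vectors.\<close>
  moreover have "underlying_space A (change_action \<pi> N) = underlying_space B N"
    by (simp add: underlying_space_def change_action_def hom_smult hom_one)
  ultimately show ?thesis
    using assms by (simp add: fd_left_module_def)
qed

lemma kernel_annihilates_pullback:
  assumes "left_module B N"
  shows "kernel_annihilates (change_action \<pi> N)"
  using left_module.act_zero[OF assms] by (auto simp: kernel_annihilates_def)

lemma fd_left_module_descend:
  assumes "fd_left_module A M" "kernel_annihilates M"
  shows "fd_left_module B (change_action lift M)"
proof -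
  interpret M: left_module A M
    using assms by (simp add: fd_left_module_def)
  note cong = act_cong[OF M.left_module_axioms assms(2)]
  \<comment> \<open>\<open>lift\<close> need not respect the operations, but \<open>lift b\<close>
    acts like every other preimage of \<open>b\<close>. For a sum or product in \<open>B\<close>,
    the preimage taken below is the sum or product of the lifts.\<close>
  have act: "lift b \<odot>\<^bsub>M\<^esub> v = a \<odot>\<^bsub>M\<^esub> v" if "a \<in> carrier A" "\<pi> a = b" "v \<in> carrier M" for a b v
    using that by (intro cong) auto
  have mod: "left_module B (change_action lift M)"
  proof (intro left_module.intro left_module_axioms.intro abelian_group_change_action)
    show "assoc_algebra B" "abelian_group M" by unfold_locales
    fix a b v assume *: "a \<in> carrier B" "b \<in> carrier B" "v \<in> carrier (change_action lift M)"
    show "(a \<oplus>\<^bsub>B\<^esub> b) \<odot>\<^bsub>change_action lift M\<^esub> v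
        = a \<odot>\<^bsub>change_action lift M\<^esub> v \<oplus>\<^bsub>change_action lift M\<^esub> b \<odot>\<^bsub>change_action lift M\<^esub> v"
      using * act[of "lift a \<oplus>\<^bsub>A\<^esub> lift b" "a \<oplus>\<^bsub>B\<^esub> b"] by (simp add: hom_add M.act_add_left)
    show "(a \<otimes>\<^bsub>B\<^esub> b) \<odot>\<^bsub>change_action lift M\<^esub> v
        = a \<odot>\<^bsub>change_action lift M\<^esub> (b \<odot>\<^bsub>change_action lift M\<^esub> v)"
      using * act[of "lift a \<otimes>\<^bsub>A\<^esub> lift b" "a \<otimes>\<^bsub>B\<^esub> b"] by (simp add: hom_mult M.act_mult)
  qed (auto simp: M.act_closed M.act_add_right M.act_one act[of "\<one>\<^bsub>A\<^esub>"] hom_one)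
  have "vectorspace.fin_dim class_ring (underlying_space B (change_action lift M))"
  proof (rule fin_dim_cong)
    show "vectorspace class_ring (underlying_space A M)"
      by (rule M.underlying_space_vectorspace)
    show "vectorspace class_ring (underlying_space B (change_action lift M))"
      by (rule left_module.underlying_space_vectorspace[OF mod])
    show "vectorspace.fin_dim class_ring (underlying_space A M)"
      using assms by (simp add: fd_left_module_def)
    fix c v assume "v \<in> carrier (underlying_space B (change_action lift M))"
    then show "c \<odot>\<^bsub>underlying_space A M\<^esub> v = c \<odot>\<^bsub>underlying_space B (change_action lift M)\<^esub> v"
      by (simp add: act[of "c \<odot>\<^bsub>A\<^esub> \<one>\<^bsub>A\<^esub>"] hom_smult hom_one)
  qed auto
  then show ?thesis
    using mod by (simp add: fd_left_module_def)
qed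

text \<open>Both functors keep the carrier and the maps and change only the action: a map commuting
  with \<open>A\<close> commutes with all lifts, and a map commuting with \<open>B\<close> commutes
  with all images under \<pi>. \<open>P\<close> stays abstract so that a concrete criterion for
  annihilation by the kernel can be inserted.\<close>

theorem equivalent_categories_annihilated:
  fixes P :: "('a, 'v) module \<Rightarrow> bool"
  assumes P: "\<And>M. fd_left_module A M \<Longrightarrow> P M \<longleftrightarrow> kernel_annihilates M"
  shows "equivalent_categories
    (full_subcategory (fd_module_category A :: (('a, 'v) module, 'v \<Rightarrow> 'v) cat) P)
    (fd_module_category B :: (('b, 'v) module, 'v \<Rightarrow> 'v) cat)"
proof -
  let ?C = "full_subcategory (fd_module_category A :: (('a, 'v) module, 'v \<Rightarrow> 'v) cat) P"
  let ?D = "fd_module_category B :: (('b, 'v) module, 'v \<Rightarrow> 'v) cat"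
  let ?Fo = "change_action lift :: ('a, 'v) module \<Rightarrow> ('b, 'v) module"
  let ?Go = "change_action \<pi> :: ('b, 'v) module \<Rightarrow> ('a, 'v) module"
  let ?m = "\<lambda>X Y f. f"
  have cats: "category ?C" "category ?D"
    by (simp_all add: category_fd_module_category category_full_subcategory)
  have Go: "?Go N \<in> Obj ?C" if "N \<in> Obj ?D" for N
  proof -
    have "fd_left_module A (?Go N)" "kernel_annihilates (?Go N)"
      using that by (auto intro: fd_left_module_pullback kernel_annihilates_pullback
        simp: fd_left_module_def[of B])
    then show ?thesis using P by simp
  qed
  have Fo: "?Fo M \<in> Obj ?D" if "M \<in> Obj ?C" for M
    using that P by (auto intro: fd_left_module_descend)
  have F: "cat_functor ?C ?D ?Fo ?m"
    using cats Fo by (auto intro!: cat_functor.intro cat_functor_axioms.intro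
      simp: LinearCombinations.module_hom_def)
  have G: "cat_functor ?D ?C ?Go ?m"
    using cats Go by (auto intro!: cat_functor.intro cat_functor_axioms.intro
      simp: LinearCombinations.module_hom_def)
  have GF: "naturally_isomorphic ?C ?C (\<lambda>X. ?Go (?Fo X)) ?m (\<lambda>X. X) ?m"
    unfolding naturally_isomorphic_def
  proof (intro exI conjI ballI)
    fix M assume M: "M \<in> Obj ?C"
    then have *: "left_module A M" "kernel_annihilates M"
      using P by (auto simp: fd_left_module_def)
    \<comment> \<open>After the round trip \<open>a\<close> acts as \<open>lift (\<pi> a)\<close>,
      which is another preimage of \<open>\<pi> a\<close>.\<close>
    have "cat_iso (fd_module_category A) (?Go (?Fo M)) M (\<lambda>v\<in>carrier M. v)"
      by (rule cat_iso_identity) (auto intro!: act_cong[OF *] * )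
    then show "cat_iso ?C (?Go (?Fo M)) M (\<lambda>v\<in>carrier M. v)"
      by (simp add: cat_iso_def)
  next
    fix M N f assume "f \<in> Hom ?C M N"
    then show "Comp ?C (?Go (?Fo M)) (?Go (?Fo N)) N (\<lambda>v\<in>carrier N. v) f
        = Comp ?C (?Go (?Fo M)) M N f (\<lambda>v\<in>carrier M. v)"
      by (auto simp: LinearCombinations.module_hom_def Id_compose compose_Id)
  qed
  have FG: "naturally_isomorphic ?D ?D (\<lambda>X. ?Fo (?Go X)) ?m (\<lambda>X. X) ?m"
    unfolding naturally_isomorphic_def
  proof (intro exI conjI ballI)
    fix N assume "N \<in> Obj ?D"
    \<comment> \<open>Here \<open>b\<close> acts as \<open>\<pi> (lift b)\<close>, which is
      \<open>b\<close> itself on the carrier of \<open>B\<close>.\<close>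
    then show "cat_iso ?D (?Fo (?Go N)) N (\<lambda>v\<in>carrier N. v)"
      by (intro cat_iso_identity) (auto simp: fd_left_module_def)
  next
    fix M N f assume "f \<in> Hom ?D M N"
    then show "Comp ?D (?Fo (?Go M)) (?Fo (?Go N)) N (\<lambda>v\<in>carrier N. v) f
        = Comp ?D (?Fo (?Go M)) M N f (\<lambda>v\<in>carrier M. v)"
      by (auto simp: LinearCombinations.module_hom_def Id_compose compose_Id)
  qed
  show ?thesis
    unfolding equivalent_categories_def using F G GF FG by blast
qed

end

section \<open>Group algebras\<close>

text \<open>\<open>a\<close> is read as a formal linear combination of points, on which
  \<open>f\<close> is evaluated linearly. Over an infinite support the sum is 0 by convention, so
  linearity in \<open>f\<close> is unconditional, while additivity in \<open>a\<close> is stated for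
  finite supports.\<close>

definition pairing :: "('x \<Rightarrow> 'f::field) \<Rightarrow> ('x \<Rightarrow> 'f) \<Rightarrow> 'f" where
  "pairing a f = (\<Sum>x | a x \<noteq> 0. a x * f x)"

lemma pairing_superset:
  assumes "finite S" "{x. a x \<noteq> 0} \<subseteq> S"
  shows "pairing a f = (\<Sum>x\<in>S. a x * f x)"
  unfolding pairing_def using assms by (intro sum.mono_neutral_left) auto

lemma pairing_cong: "(\<And>x. a x \<noteq> 0 \<Longrightarrow> f x = h x) \<Longrightarrow> pairing a f = pairing a h"
  unfolding pairing_def by (intro sum.cong) auto

lemma pairing_add_right: "pairing a (\<lambda>x. f x + h x) = pairing a f + pairing a h"
  by (simp add: pairing_def algebra_simps sum.distrib)

lemma pairing_scale_right: "pairing a (\<lambda>x. c * f x) = c * pairing a f"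
  by (simp add: pairing_def algebra_simps sum_distrib_left)

lemma pairing_sum_right: "pairing a (\<lambda>x. \<Sum>i\<in>I. c i * f i x) = (\<Sum>i\<in>I. c i * pairing a (f i))"
  unfolding pairing_def sum_distrib_left
  by (subst sum.swap) (simp add: algebra_simps)

lemma pairing_add_left:
  assumes "finite {x. a x \<noteq> 0}" "finite {x. b x \<noteq> 0}"
  shows "pairing (\<lambda>x. a x + b x) f = pairing a f + pairing b f"
proof -
  let ?S = "{x. a x \<noteq> 0} \<union> {x. b x \<noteq> 0}"
  have "pairing (\<lambda>x. a x + b x) f = (\<Sum>x\<in>?S. (a x + b x) * f x)"
    using assms by (intro pairing_superset) auto
  also have "\<dots> = (\<Sum>x\<in>?S. a x * f x) + (\<Sum>x\<in>?S. b x * f x)"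
    by (simp add: algebra_simps sum.distrib)
  also have "(\<Sum>x\<in>?S. a x * f x) = pairing a f"
    using assms by (intro pairing_superset[symmetric]) auto
  also have "(\<Sum>x\<in>?S. b x * f x) = pairing b f"
    using assms by (intro pairing_superset[symmetric]) auto
  finally show ?thesis .
qed

lemma pairing_scale_left: "pairing (\<lambda>x. c * a x) f = c * pairing a f"
  \<comment> \<open>For nonzero \<open>c\<close> the supports of \<open>a\<close> and
    \<open>c * a\<close> agree, whereas \<open>c = 0\<close> empties the support.\<close>
  by (cases "c = 0") (simp_all add: pairing_def algebra_simps sum_distrib_left)

lemma finite_support_sum:
  assumes "finite I" "\<And>i. i \<in> I \<Longrightarrow> finite {x. u i x \<noteq> (0::'f::field)}"
  shows "finite {x. (\<Sum>i\<in>I. t i * u i x) \<noteq> 0}"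
proof (rule finite_subset)
  show "{x. (\<Sum>i\<in>I. t i * u i x) \<noteq> 0} \<subseteq> (\<Union>i\<in>I. {x. u i x \<noteq> 0})"
    by (auto intro: ccontr sum.neutral)
qed (use assms in auto)

lemma pairing_sum_left:
  assumes "finite I" "\<And>i. i \<in> I \<Longrightarrow> finite {x. u i x \<noteq> 0}"
  shows "pairing (\<lambda>x. \<Sum>i\<in>I. t i * u i x) f = (\<Sum>i\<in>I. t i * pairing (u i) f)"
  using assms
proof (induction I rule: finite_induct)
  case empty
  then show ?case by (simp add: pairing_def)
next
  case (insert j I)
  have "finite {x. t j * u j x \<noteq> 0}"
    by (rule finite_subset[of _ "{x. u j x \<noteq> 0}"]) (use insert in auto)
  then show ?case
    using insert by (simp add: pairing_add_left pairing_scale_left finite_support_sum)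
qed

lemma pairing_group_elem [simp]: "pairing (group_elem h) f = f h"
  by (simp add: pairing_def group_elem_def)

section \<open>The group algebra and its convolution product\<close>

lemma group_algebra_simps [simp]:
  "carrier (group_algebra G) = {a. finite {g. a g \<noteq> 0} \<and> {g. a g \<noteq> 0} \<subseteq> carrier G}"
  "one (group_algebra G) = group_elem \<one>\<^bsub>G\<^esub>"
  "zero (group_algebra G) = (\<lambda>g. 0)"
  "add (group_algebra G) = (\<lambda>a b g. a g + b g)"
  "smult (group_algebra G) = (\<lambda>c a g. c * a g)"
  by (simp_all add: group_algebra_def group_elem_def)

text \<open>The coefficient at \<open>g\<close> is a double pairing with the indicator of the pairs
  whose product is \<open>g\<close>. The ring laws thereby reduce to properties of
  \<open>pairing\<close>.\<close>

lemma group_algebra_mult: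
  "mult (group_algebra G) a b g
    = pairing a (\<lambda>h. pairing b (\<lambda>k. if h \<otimes>\<^bsub>G\<^esub> k = g then 1 else 0))"
  by (auto simp: group_algebra_def pairing_def sum_distrib_left if_distrib cong: if_cong
      intro!: sum.cong)

context group
begin

lemma group_elem_closed [simp]: "g \<in> carrier G \<Longrightarrow> group_elem g \<in> carrier (group_algebra G)"
  by (auto simp: group_elem_def)

lemma support_mult:
  "{g. mult (group_algebra G) a b g \<noteq> 0} \<subseteq> (\<lambda>(h, k). h \<otimes> k) ` ({h. a h \<noteq> 0} \<times> {k. b k \<noteq> 0})"
proof
  fix g assume g: "g \<in> {g. mult (group_algebra G) a b g \<noteq> 0}"
  show "g \<in> (\<lambda>(h, k). h \<otimes> k) ` ({h. a h \<noteq> 0} \<times> {k. b k \<noteq> 0})"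
  proof (rule ccontr)
    assume "\<not> ?thesis"
    then have "\<And>h k. a h \<noteq> 0 \<Longrightarrow> b k \<noteq> 0 \<Longrightarrow> h \<otimes> k \<noteq> g" by force
    then have "mult (group_algebra G) a b g = 0"
      unfolding group_algebra_mult pairing_def by (auto intro!: sum.neutral)
    then show False using g by simp
  qed
qed

lemma group_algebra_mult_closed:
  assumes "a \<in> carrier (group_algebra G)" "b \<in> carrier (group_algebra G)"
  shows "mult (group_algebra G) a b \<in> carrier (group_algebra G)"
proof -
  have "finite ((\<lambda>(h, k). h \<otimes> k) ` ({h. a h \<noteq> 0} \<times> {k. b k \<noteq> 0}))"
    using assms by auto
  moreover have "(\<lambda>(h, k). h \<otimes> k) ` ({h. a h \<noteq> 0} \<times> {k. b k \<noteq> 0}) \<subseteq> carrier G"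
    using assms by auto
  ultimately show ?thesis
    using support_mult[of a b] by (auto intro: finite_subset)
qed

text \<open>A function is evaluated on a convolution by pulling it back along the group
  multiplication. Associativity of the group algebra and multiplicativity of the evaluation map both
  rest on this.\<close>

lemma pairing_mult:
  assumes "a \<in> carrier (group_algebra G)" "b \<in> carrier (group_algebra G)"
  shows "pairing (mult (group_algebra G) a b) f = pairing a (\<lambda>h. pairing b (\<lambda>k. f (h \<otimes> k)))"
proof -
  let ?A = "{h. a h \<noteq> 0}" and ?B = "{k. b k \<noteq> 0}"
  let ?S = "(\<lambda>(h, k). h \<otimes> k) ` (?A \<times> ?B)"
  have fin: "finite ?S" using assms by auto
  have "pairing (mult (group_algebra G) a b) f
      = (\<Sum>g\<in>?S. (\<Sum>h\<in>?A. \<Sum>k\<in>?B. a h * b k * (if h \<otimes> k = g then 1 else 0)) * f g)"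
    by (subst pairing_superset[OF fin support_mult])
      (simp add: group_algebra_mult pairing_def sum_distrib_left mult.assoc)
  \<comment> \<open>The sum over \<open>g\<close> is moved inside, where only the term
    \<open>g = h \<otimes> k\<close> survives.\<close>
  also have "\<dots> = (\<Sum>h\<in>?A. \<Sum>k\<in>?B. \<Sum>g\<in>?S. a h * b k * (if h \<otimes> k = g then 1 else 0) * f g)"
    unfolding sum_distrib_right
    by (subst sum.swap, rule sum.cong[OF refl], subst sum.swap, rule refl)
  also have "\<dots> = (\<Sum>h\<in>?A. \<Sum>k\<in>?B. a h * b k * f (h \<otimes> k))"
  proof (intro sum.cong refl)
    fix h k assume "h \<in> ?A" "k \<in> ?B"
    then have hk: "h \<otimes> k \<in> ?S" by force
    have "(\<Sum>g\<in>?S. a h * b k * (if h \<otimes> k = g then 1 else 0) * f g)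
        = (\<Sum>g\<in>?S. if h \<otimes> k = g then a h * b k * f g else 0)"
      by (intro sum.cong) auto
    then show "(\<Sum>g\<in>?S. a h * b k * (if h \<otimes> k = g then 1 else 0) * f g) = a h * b k * f (h \<otimes> k)"
      using hk fin by (simp add: sum.delta')
  qed
  also have "\<dots> = pairing a (\<lambda>h. pairing b (\<lambda>k. f (h \<otimes> k)))"
    by (simp add: pairing_def sum_distrib_left mult.assoc)
  finally show ?thesis .
qed

lemma abelian_group_group_algebra:
  "abelian_group (group_algebra G :: ('f::field, 'a \<Rightarrow> 'f) module)"
proof (rule abelian_groupI)
  let ?FG = "group_algebra G :: ('f, 'a \<Rightarrow> 'f) module"
  fix a b :: "'a \<Rightarrow> 'f" assume a: "a \<in> carrier ?FG" and b: "b \<in> carrier ?FG"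
  have "{g. a g + b g \<noteq> 0} \<subseteq> {g. a g \<noteq> 0} \<union> {g. b g \<noteq> 0}" by auto
  then show "a \<oplus>\<^bsub>?FG\<^esub> b \<in> carrier ?FG"
    using a b by (auto intro: finite_subset)
next
  let ?FG = "group_algebra G :: ('f, 'a \<Rightarrow> 'f) module"
  fix a :: "'a \<Rightarrow> 'f" assume "a \<in> carrier ?FG"
  then show "\<exists>b\<in>carrier ?FG. b \<oplus>\<^bsub>?FG\<^esub> a = \<zero>\<^bsub>?FG\<^esub>"
    by (intro bexI[of _ "\<lambda>g. - a g"]) auto
qed (auto simp: algebra_simps)

lemma assoc_algebra_group_algebra:
  "assoc_algebra (group_algebra G :: ('f::field, 'a \<Rightarrow> 'f) module)"
proof (rule assoc_algebra.intro)
  let ?FG = "group_algebra G :: ('f, 'a \<Rightarrow> 'f) module"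
  have "module (class_ring :: 'f ring) ?FG"
  proof (rule Module.module.intro)
    show "cring (class_ring :: 'f ring)" by unfold_locales
    show "abelian_group ?FG" by (rule abelian_group_group_algebra)
    show "module_axioms (class_ring :: 'f ring) ?FG"
    proof
      fix c :: 'f and a :: "'a \<Rightarrow> 'f" assume a: "a \<in> carrier ?FG"
      have "{g. c * a g \<noteq> 0} \<subseteq> {g. a g \<noteq> 0}" by auto
      then show "c \<odot>\<^bsub>?FG\<^esub> a \<in> carrier ?FG"
        using a by (auto intro: finite_subset)
    qed (auto simp: algebra_simps)
  qed
  then show "vectorspace (class_ring :: 'f ring) ?FG"
    using class_field by (simp add: vectorspace_def)
  show "ring ?FG"
  proof (rule ringI[OF abelian_group_group_algebra])
    show "monoid ?FG"
    proof (rule monoidI)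
      fix a b c :: "'a \<Rightarrow> 'f"
      assume abc: "a \<in> carrier ?FG" "b \<in> carrier ?FG" "c \<in> carrier ?FG"
      show "a \<otimes>\<^bsub>?FG\<^esub> b \<in> carrier ?FG"
        by (rule group_algebra_mult_closed) fact+
      show "a \<otimes>\<^bsub>?FG\<^esub> b \<otimes>\<^bsub>?FG\<^esub> c = a \<otimes>\<^bsub>?FG\<^esub> (b \<otimes>\<^bsub>?FG\<^esub> c)"
      proof
        fix g
        \<comment> \<open>A coefficient at \<open>g\<close> is itself a pairing with indicators, so
          \<open>pairing_mult\<close> unfolds either bracketing into a triple pairing; associativity
          in the group compares the two.\<close>
        have "(a \<otimes>\<^bsub>?FG\<^esub> b \<otimes>\<^bsub>?FG\<^esub> c) g
            = pairing a (\<lambda>h. pairing b (\<lambda>k. pairing c (\<lambda>l. if h \<otimes> k \<otimes> l = g then 1 else 0)))"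
          using abc by (subst group_algebra_mult) (subst pairing_mult, simp_all)
        also have "\<dots> = pairing a (\<lambda>h. pairing b (\<lambda>k. pairing c (\<lambda>l. if h \<otimes> (k \<otimes> l) = g then 1 else 0)))"
          using abc by (intro pairing_cong) (auto simp: m_assoc subset_iff)
        also have "\<dots> = (a \<otimes>\<^bsub>?FG\<^esub> (b \<otimes>\<^bsub>?FG\<^esub> c)) g"
          using abc by (subst group_algebra_mult) (subst pairing_mult, simp_all)
        finally show "(a \<otimes>\<^bsub>?FG\<^esub> b \<otimes>\<^bsub>?FG\<^esub> c) g = (a \<otimes>\<^bsub>?FG\<^esub> (b \<otimes>\<^bsub>?FG\<^esub> c)) g" .
      qed
    next
      show "\<one>\<^bsub>?FG\<^esub> \<in> carrier ?FG"
        using group_elem_closed[OF one_closed] by simp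
      fix a :: "'a \<Rightarrow> 'f" assume a: "a \<in> carrier ?FG"
      have eq: "pairing a (\<lambda>k. if k = g then 1 else 0) = a g" for g
        using a by (simp add: pairing_def if_distrib cong: if_cong)
      show "\<one>\<^bsub>?FG\<^esub> \<otimes>\<^bsub>?FG\<^esub> a = a"
      proof
        fix g
        have "(\<one>\<^bsub>?FG\<^esub> \<otimes>\<^bsub>?FG\<^esub> a) g = pairing a (\<lambda>k. if k = g then 1 else 0)"
          using a by (auto simp: group_algebra_mult subset_iff intro!: pairing_cong)
        then show "(\<one>\<^bsub>?FG\<^esub> \<otimes>\<^bsub>?FG\<^esub> a) g = a g" by (simp add: eq)
      qed
      show "a \<otimes>\<^bsub>?FG\<^esub> \<one>\<^bsub>?FG\<^esub> = a"
      proof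
        fix g
        have "(a \<otimes>\<^bsub>?FG\<^esub> \<one>\<^bsub>?FG\<^esub>) g = pairing a (\<lambda>k. if k = g then 1 else 0)"
          using a by (auto simp: group_algebra_mult subset_iff intro!: pairing_cong)
        then show "(a \<otimes>\<^bsub>?FG\<^esub> \<one>\<^bsub>?FG\<^esub>) g = a g" by (simp add: eq)
      qed
    qed
    fix a b c :: "'a \<Rightarrow> 'f"
    assume "a \<in> carrier ?FG" "b \<in> carrier ?FG" "c \<in> carrier ?FG"
    then show "(a \<oplus>\<^bsub>?FG\<^esub> b) \<otimes>\<^bsub>?FG\<^esub> c = a \<otimes>\<^bsub>?FG\<^esub> c \<oplus>\<^bsub>?FG\<^esub> b \<otimes>\<^bsub>?FG\<^esub> c"
      "c \<otimes>\<^bsub>?FG\<^esub> (a \<oplus>\<^bsub>?FG\<^esub> b) = c \<otimes>\<^bsub>?FG\<^esub> a \<oplus>\<^bsub>?FG\<^esub> c \<otimes>\<^bsub>?FG\<^esub> b"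
      by (auto simp: group_algebra_mult pairing_add_left pairing_add_right)
  qed
qed (simp_all add: group_algebra_mult fun_eq_iff pairing_scale_left pairing_scale_right)

lemma finsum_group_algebra:
  fixes f :: "'i \<Rightarrow> 'a \<Rightarrow> 'f::field"
  assumes "finite I" "\<And>i. i \<in> I \<Longrightarrow> f i \<in> carrier (group_algebra G)"
  shows "finsum (group_algebra G :: ('f, 'a \<Rightarrow> 'f) module) f I = (\<lambda>g. \<Sum>i\<in>I. f i g)"
proof -
  let ?FG = "group_algebra G :: ('f, 'a \<Rightarrow> 'f) module"
  interpret abelian_group ?FG by (rule abelian_group_group_algebra)
  show ?thesis
    using assms
  proof (induction I rule: finite_induct)
    case empty
    then show ?case by (simp only: finsum_empty) simp
  next
    case (insert j I)
    have "finsum ?FG f (insert j I) = f j \<oplus>\<^bsub>?FG\<^esub> finsum ?FG f I"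
      by (rule finsum_insert) (use insert in auto)
    then show ?case
      using insert by simp
  qed
qed

end

section \<open>Finite-dimensional spaces of functions\<close>

text \<open>
  A finite set of functions has a maximal linearly independent subset \<open>B\<close>, and evaluations at
  points separate the functions, so that some finite combinations \<open>u i\<close> of evaluations form the
  basis dual to \<open>B\<close>.
\<close>

lemma dual_system:
  fixes T :: "('x \<Rightarrow> 'f::field) set"
  assumes "finite T" "\<And>f x. f \<in> T \<Longrightarrow> x \<notin> X \<Longrightarrow> f x = 0"
  shows "\<exists>B u. B \<subseteq> T \<and> (\<forall>i\<in>B. finite {x. u i x \<noteq> 0} \<and> {x. u i x \<noteq> 0} \<subseteq> X) \<and>
    (\<forall>i\<in>B. \<forall>j\<in>B. pairing (u i) j = (if i = j then 1 else 0)) \<and>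
    (\<forall>f\<in>T. \<forall>x. f x = (\<Sum>i\<in>B. pairing (u i) f * i x))"
  using assms
proof (induction T rule: finite_induct)
  case empty
  then show ?case by auto
next
  case (insert f T)
  have "\<exists>B u. B \<subseteq> T \<and> (\<forall>i\<in>B. finite {x. u i x \<noteq> 0} \<and> {x. u i x \<noteq> 0} \<subseteq> X) \<and>
      (\<forall>i\<in>B. \<forall>j\<in>B. pairing (u i) j = (if i = j then 1 else 0)) \<and>
      (\<forall>f\<in>T. \<forall>x. f x = (\<Sum>i\<in>B. pairing (u i) f * i x))"
    by (rule insert.IH) (use insert.prems in auto)
  then obtain B u where Bu: "B \<subseteq> T \<and> (\<forall>i\<in>B. finite {x. u i x \<noteq> 0} \<and> {x. u i x \<noteq> 0} \<subseteq> X) \<and>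
      (\<forall>i\<in>B. \<forall>j\<in>B. pairing (u i) j = (if i = j then 1 else 0)) \<and>
      (\<forall>f\<in>T. \<forall>x. f x = (\<Sum>i\<in>B. pairing (u i) f * i x))"
    by (elim exE)
  have B: "B \<subseteq> T"
    and u: "\<And>i. i \<in> B \<Longrightarrow> finite {x. u i x \<noteq> 0}" "\<And>i. i \<in> B \<Longrightarrow> {x. u i x \<noteq> 0} \<subseteq> X"
    and dual: "\<And>i j. i \<in> B \<Longrightarrow> j \<in> B \<Longrightarrow> pairing (u i) j = (if i = j then 1 else 0)"
    and span: "\<And>h x. h \<in> T \<Longrightarrow> h x = (\<Sum>i\<in>B. pairing (u i) h * i x)"
    using Bu by blast+
  have finB: "finite B" using B insert(1) finite_subset by blast
  show ?case
  \<comment> \<open>If \<open>f\<close> is already spanned by \<open>B\<close>, nothing changes;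
    otherwise \<open>f\<close> joins the basis.\<close>
  proof (cases "\<forall>x. f x = (\<Sum>i\<in>B. pairing (u i) f * i x)")
    case True
    then show ?thesis
      using B u dual span by (intro exI[of _ B] exI[of _ u]) auto
  next
    case False
    then obtain y where y: "f y \<noteq> (\<Sum>i\<in>B. pairing (u i) f * i y)" by blast
    \<comment> \<open>All functions involved vanish outside \<open>X\<close>, so a point of
      disagreement lies in \<open>X\<close>, and so does the support of evaluation at
      \<open>y\<close>.\<close>
    have yX: "y \<in> X"
    proof (rule ccontr)
      assume "y \<notin> X"
      then have "f y = 0" "\<And>i. i \<in> B \<Longrightarrow> i y = 0" using insert.prems B by auto
      then show False using y by simp
    qed
    have fB: "f \<notin> B" using B insert by auto
    \<comment> \<open>Evaluation at \<open>y\<close>, corrected so as to vanish on \<open>B\<close>.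
      On any \<open>h\<close> it measures the failure at \<open>y\<close> of the expansion of
      \<open>h\<close> in \<open>B\<close>; for \<open>f\<close> this is nonzero by the choice of
      \<open>y\<close>.\<close>
    define w where "w = (\<lambda>x. group_elem y x + (-1) * (\<Sum>i\<in>B. i y * u i x))"
    have w_fin: "finite {x. w x \<noteq> 0}" and w_X: "{x. w x \<noteq> 0} \<subseteq> X"
    proof -
      have sub: "{x. w x \<noteq> 0} \<subseteq> insert y (\<Union>i\<in>B. {x. u i x \<noteq> 0})"
        by (auto simp: w_def group_elem_def intro!: sum.neutral split: if_splits)
      show "finite {x. w x \<noteq> 0}"
        by (rule finite_subset[OF sub]) (use finB u in auto)
      show "{x. w x \<noteq> 0} \<subseteq> X"
        using sub yX u(2) by blast
    qed
    have w: "pairing w h = h y - (\<Sum>i\<in>B. i y * pairing (u i) h)" for h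
    proof -
      have 1: "finite {x. group_elem y x \<noteq> (0::'f)}" by (simp add: group_elem_def)
      have 2: "finite {x. (-1) * (\<Sum>i\<in>B. i y * u i x) \<noteq> 0}"
        using finite_support_sum[of B u "\<lambda>i. i y"] finB u by simp
      show ?thesis
        unfolding w_def pairing_add_left[OF 1 2] pairing_scale_left
        using pairing_sum_left[of B u "\<lambda>i. i y" h] finB u by simp
    qed
    have w_B: "pairing w h = 0" if "h \<in> B" for h
    proof -
      have "(\<Sum>i\<in>B. i y * pairing (u i) h) = (\<Sum>i\<in>B. if i = h then i y else 0)"
        using that by (intro sum.cong) (auto simp: dual)
      then show ?thesis using that finB by (simp add: w)
    qed
    define c where "c = pairing w f"
    have c: "c \<noteq> 0"
      using y by (simp add: c_def w mult.commute)
    \<comment> \<open>\<open>w / c\<close> becomes the dual element of \<open>f\<close>. Subtracting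
      a multiple of \<open>w\<close> makes each old dual element vanish on \<open>f\<close> and
      keeps its values on \<open>B\<close>.\<close>
    define v where "v = (\<lambda>i. if i = f then (\<lambda>x. (1 / c) * w x)
      else (\<lambda>x. u i x + (- (pairing (u i) f / c)) * w x))"
    have v_f: "pairing (v f) h = pairing w h / c" for h
      by (simp add: v_def pairing_scale_left[of "1 / c", simplified])
    have v_B: "pairing (v i) h = pairing (u i) h - pairing (u i) f / c * pairing w h" if "i \<in> B" for i h
    proof -
      have "i \<noteq> f" using that fB by auto
      moreover have "finite {x. (- (pairing (u i) f / c)) * w x \<noteq> 0}"
        by (rule finite_subset[OF _ w_fin]) auto
      ultimately show ?thesis
        using u that by (simp only: v_def if_False pairing_add_left pairing_scale_left) simp
    qed
    have v_supp: "{x. v i x \<noteq> 0} \<subseteq> (if i \<in> B then {x. u i x \<noteq> 0} else {}) \<union> {x. w x \<noteq> 0}"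
      if "i \<in> insert f B" for i
      using that by (auto simp: v_def)
    have "finite {x. v i x \<noteq> 0} \<and> {x. v i x \<noteq> 0} \<subseteq> X" if "i \<in> insert f B" for i
      using v_supp[OF that] u[of i] w_fin w_X
      by (intro conjI, intro finite_subset[OF v_supp[OF that]]) (auto split: if_splits)
    moreover have "pairing (v i) j = (if i = j then 1 else 0)" if "i \<in> insert f B" "j \<in> insert f B" for i j
      using that fB c by (auto simp: v_f v_B dual w_B c_def[symmetric])
    moreover have "h x = (\<Sum>i\<in>insert f B. pairing (v i) h * i x)" if "h \<in> insert f T" for h x
    proof -
      have *: "(\<Sum>i\<in>insert f B. pairing (v i) h * i x)
          = pairing w h / c * f x + (\<Sum>i\<in>B. (pairing (u i) h - pairing (u i) f / c * pairing w h) * i x)"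
        using finB fB by (simp add: v_f v_B)
      show ?thesis
      proof (cases "h = f")
        case True
        then show ?thesis
          unfolding * using c by (simp add: c_def[symmetric])
      next
        case False
        then have h: "h \<in> T" using that by simp
        \<comment> \<open>The old expansion of \<open>h\<close> holds at \<open>y\<close>, so its
          failure there is zero and the corrections do not affect \<open>h\<close>.\<close>
        have "pairing w h = 0"
          using span[OF h, of y] by (simp add: w mult.commute)
        then show ?thesis
          unfolding * using span[OF h] by simp
      qed
    qed
    ultimately show ?thesis
      using B by (intro exI[of _ "insert f B"] exI[of _ v]) blast
  qed
qed

section \<open>Polynomial functions of bounded degree\<close>

definition bounded_exponents :: "nat \<Rightarrow> nat \<Rightarrow> (nat \<times> nat \<Rightarrow> nat) set" where
  "bounded_exponents d n = (\<Union>r\<le>n. exponents d r)"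

lemma finite_exponents: "finite (exponents d r)"
proof (rule finite_subset)
  show "exponents d r \<subseteq> ({..<d} \<times> {..<d}) \<rightarrow>\<^sub>E {..r}"
  proof
    fix m assume m: "m \<in> exponents d r"
    have "m p \<le> r" if "p \<in> {..<d} \<times> {..<d}" for p
    proof -
      have "m p \<le> (\<Sum>p\<in>{..<d} \<times> {..<d}. m p)"
        by (rule member_le_sum[OF that]) auto
      then show ?thesis using m by (simp add: exponents_def)
    qed
    then show "m \<in> ({..<d} \<times> {..<d}) \<rightarrow>\<^sub>E {..r}"
      using m by (auto simp: exponents_def PiE_iff)
  qed
qed (auto intro!: finite_PiE)

lemma finite_bounded_exponents: "finite (bounded_exponents d n)"
  by (simp add: bounded_exponents_def finite_exponents)

text \<open>The sets \<open>exponents d r\<close> are disjoint, since \<open>r\<close> is the total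
  degree of their members. Choosing a homogeneous part in each degree up to \<open>n\<close> thus
  amounts to one family of coefficients.\<close>

lemma coeff_space_eq:
  "coeff_space d n
    = {f. \<exists>a. f = (\<lambda>g. \<Sum>m\<in>bounded_exponents d n. a m * (monomial_fun d m g :: 'f::field))}"
proof -
  have sum_UN: "(\<Sum>m\<in>bounded_exponents d n. F m) = (\<Sum>r\<le>n. \<Sum>m\<in>exponents d r. F m)"
    for F :: "(nat \<times> nat \<Rightarrow> nat) \<Rightarrow> 'f"
    unfolding bounded_exponents_def
    by (rule sum.UNION_disjoint) (auto simp: finite_exponents, auto simp: exponents_def)
  show ?thesis
  proof (intro equalityI subsetI)
    fix f :: "'f mat \<Rightarrow> 'f" assume "f \<in> coeff_space d n"
    then obtain h where h: "\<forall>r\<le>n. h r \<in> homogeneous_funs d r" "f = (\<lambda>g. \<Sum>r\<le>n. h r g)"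
      by (auto simp: coeff_space_def)
    then have "\<forall>r. \<exists>a. r \<le> n \<longrightarrow> h r = (\<lambda>g. \<Sum>m\<in>exponents d r. a m * monomial_fun d m g)"
      by (auto simp: homogeneous_funs_def)
    then obtain a where a: "\<And>r. r \<le> n \<Longrightarrow> h r = (\<lambda>g. \<Sum>m\<in>exponents d r. a r m * monomial_fun d m g)"
      by metis
    \<comment> \<open>The total degree of \<open>m\<close> tells from which homogeneous part its
      coefficient is taken.\<close>
    let ?a = "\<lambda>m. a (\<Sum>p\<in>{..<d} \<times> {..<d}. m p) m"
    have "f = (\<lambda>g. \<Sum>m\<in>bounded_exponents d n. ?a m * monomial_fun d m g)"
      unfolding h sum_UN by (intro ext sum.cong) (auto simp: a exponents_def)
    then show "f \<in> {f. \<exists>a. f = (\<lambda>g. \<Sum>m\<in>bounded_exponents d n. a m * (monomial_fun d m g :: 'f))}"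
      by (intro CollectI exI[of _ ?a])
  next
    fix f :: "'f mat \<Rightarrow> 'f"
    assume "f \<in> {f. \<exists>a. f = (\<lambda>g. \<Sum>m\<in>bounded_exponents d n. a m * (monomial_fun d m g :: 'f))}"
    then obtain a where "f = (\<lambda>g. \<Sum>r\<le>n. \<Sum>m\<in>exponents d r. a m * monomial_fun d m g)"
      by (auto simp: sum_UN)
    then show "f \<in> coeff_space d n"
      unfolding coeff_space_def homogeneous_funs_def by (intro CollectI exI[of _ "\<lambda>r g. \<Sum>m\<in>exponents d r. a m * monomial_fun d m g"]) auto
  qed
qed

section \<open>Linear structure and dual bases of the coefficient space\<close>

lemma polynomial_in_coeff_space:
  "(\<lambda>g. \<Sum>m\<in>bounded_exponents d n. a m * monomial_fun d m g) \<in> coeff_space d n"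
  unfolding coeff_space_eq by (intro CollectI exI[of _ a] refl)

lemma coeff_space_add:
  assumes "f \<in> coeff_space d n" "h \<in> coeff_space d n"
  shows "(\<lambda>g. f g + h g) \<in> coeff_space d n"
proof -
  obtain a b where "f = (\<lambda>g. \<Sum>m\<in>bounded_exponents d n. a m * monomial_fun d m g)"
    "h = (\<lambda>g. \<Sum>m\<in>bounded_exponents d n. b m * monomial_fun d m g)"
    using assms by (auto simp: coeff_space_eq)
  then have "(\<lambda>g. f g + h g) = (\<lambda>g. \<Sum>m\<in>bounded_exponents d n. (a m + b m) * monomial_fun d m g)"
    by (simp add: algebra_simps sum.distrib)
  then show ?thesis
    using polynomial_in_coeff_space[where a = "\<lambda>m. a m + b m"] by simp
qed

lemma coeff_space_scale:
  assumes "f \<in> coeff_space d n"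
  shows "(\<lambda>g. c * f g) \<in> coeff_space d n"
proof -
  obtain a where "f = (\<lambda>g. \<Sum>m\<in>bounded_exponents d n. a m * monomial_fun d m g)"
    using assms by (auto simp: coeff_space_eq)
  then have "(\<lambda>g. c * f g) = (\<lambda>g. \<Sum>m\<in>bounded_exponents d n. (c * a m) * monomial_fun d m g)"
    by (simp add: algebra_simps sum_distrib_left)
  then show ?thesis
    using polynomial_in_coeff_space[where a = "\<lambda>m. c * a m"] by simp
qed

lemma coeff_space_sum:
  assumes "finite I" "\<And>i. i \<in> I \<Longrightarrow> f i \<in> coeff_space d n"
  shows "(\<lambda>g. \<Sum>i\<in>I. c i * f i g) \<in> coeff_space d n"
  using assms
proof (induction I rule: finite_induct)
  case empty
  show ?case using polynomial_in_coeff_space[where a = "\<lambda>m. 0"] by simp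
next
  case (insert j I)
  then have "(\<lambda>g. c j * f j g + (\<Sum>i\<in>I. c i * f i g)) \<in> coeff_space d n"
    by (intro coeff_space_add coeff_space_scale) auto
  then show ?case using insert by simp
qed

lemma monomial_fun_in_coeff_space:
  assumes "m \<in> bounded_exponents d n"
  shows "monomial_fun d m \<in> coeff_space d n"
proof -
  have "monomial_fun d m = (\<lambda>g. \<Sum>m'\<in>bounded_exponents d n. (if m' = m then 1 else 0) * monomial_fun d m' g)"
    using assms finite_bounded_exponents by (simp add: if_distrib[of "\<lambda>x. x * _"] cong: if_cong)
  also have "\<dots> \<in> coeff_space d n"
    by (rule polynomial_in_coeff_space)
  finally show ?thesis .
qed

lemma coeff_space_outside: "f \<in> coeff_space d n \<Longrightarrow> g \<notin> carrier (GL d) \<Longrightarrow> f g = 0"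
  by (auto simp: coeff_space_eq monomial_fun_def)

text \<open>\<open>dual_system\<close> is applied to the finite set of monomial functions; these
  vanish off the group, so the \<open>u i\<close> lie in the group algebra. The expansion passes
  from monomials to polynomials because \<open>pairing (u i)\<close> is linear.\<close>

lemma coeff_space_dual_system:
  obtains B u where "finite B" "B \<subseteq> (coeff_space d n :: ('f::field mat \<Rightarrow> 'f) set)"
    "\<And>i. i \<in> B \<Longrightarrow> u i \<in> carrier (group_algebra (GL d))"
    "\<And>f. f \<in> coeff_space d n \<Longrightarrow> f = (\<lambda>g. \<Sum>i\<in>B. pairing (u i) f * i g)"
proof -
  let ?T = "monomial_fun d ` bounded_exponents d n :: ('f mat \<Rightarrow> 'f) set"
  have finT: "finite ?T" by (simp add: finite_bounded_exponents)
  have out: "f g = 0" if "f \<in> ?T" "g \<notin> carrier (GL d)" for f g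
    using that by (auto simp: monomial_fun_def)
  have "\<exists>B u. B \<subseteq> ?T \<and> (\<forall>i\<in>B. finite {g. u i g \<noteq> 0} \<and> {g. u i g \<noteq> 0} \<subseteq> carrier (GL d)) \<and>
      (\<forall>i\<in>B. \<forall>j\<in>B. pairing (u i) j = (if i = j then 1 else 0)) \<and>
      (\<forall>f\<in>?T. \<forall>g. f g = (\<Sum>i\<in>B. pairing (u i) f * i g))"
    by (rule dual_system[OF finT]) (rule out)
  then obtain B u where Bu: "B \<subseteq> ?T \<and> (\<forall>i\<in>B. finite {g. u i g \<noteq> 0} \<and> {g. u i g \<noteq> 0} \<subseteq> carrier (GL d)) \<and>
      (\<forall>i\<in>B. \<forall>j\<in>B. pairing (u i) j = (if i = j then 1 else 0)) \<and>
      (\<forall>f\<in>?T. \<forall>g. f g = (\<Sum>i\<in>B. pairing (u i) f * i g))"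
    by (elim exE)
  have B: "B \<subseteq> ?T"
    and u: "\<And>i. i \<in> B \<Longrightarrow> finite {g. u i g \<noteq> 0} \<and> {g. u i g \<noteq> 0} \<subseteq> carrier (GL d)"
    and span: "\<And>h g. h \<in> ?T \<Longrightarrow> h g = (\<Sum>i\<in>B. pairing (u i) h * i g)"
    using Bu by blast+
  show thesis
  proof (rule that[of B u])
    show "finite B" using B finT finite_subset by blast
    show "B \<subseteq> coeff_space d n"
      using B monomial_fun_in_coeff_space by blast
    show "\<And>i. i \<in> B \<Longrightarrow> u i \<in> carrier (group_algebra (GL d))"
      using u by simp
    fix f :: "'f mat \<Rightarrow> 'f" assume "f \<in> coeff_space d n"
    then obtain a where a: "f = (\<lambda>g. \<Sum>m\<in>bounded_exponents d n. a m * monomial_fun d m g)"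
      by (auto simp: coeff_space_eq)
    show "f = (\<lambda>g. \<Sum>i\<in>B. pairing (u i) f * i g)"
    proof
      fix g
      have "f g = (\<Sum>m\<in>bounded_exponents d n. a m * (\<Sum>i\<in>B. pairing (u i) (monomial_fun d m) * i g))"
        unfolding a by (intro sum.cong refl arg_cong[of _ _ "(*) _"] span) auto
      also have "\<dots> = (\<Sum>i\<in>B. \<Sum>m\<in>bounded_exponents d n. a m * pairing (u i) (monomial_fun d m) * i g)"
        unfolding sum_distrib_left by (subst sum.swap) (simp add: mult.assoc)
      also have "\<dots> = (\<Sum>i\<in>B. pairing (u i) f * i g)"
        unfolding a pairing_sum_right sum_distrib_right ..
      finally show "f g = (\<Sum>i\<in>B. pairing (u i) f * i g)" .
    qed
  qed
qed

text \<open>Factors over \<open>X\<close> belonging to the same matrix entry are collected: the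
  exponents are the sizes of the fibres of \<open>x \<mapsto> (\<alpha> x, \<beta> x)\<close>, and
  they add up to \<open>card X\<close>.\<close>

lemma c_fun_eq_monomial_fun:
  assumes "finite X" "\<alpha> \<in> Maps d X" "\<beta> \<in> Maps d X"
  defines "m \<equiv> \<lambda>p\<in>{..<d} \<times> {..<d}. card {x\<in>X. (\<alpha> x, \<beta> x) = p}"
  shows "c_fun d X \<alpha> \<beta> = (monomial_fun d m :: 'f::field mat \<Rightarrow> 'f)" "m \<in> exponents d (card X)"
proof -
  let ?S = "{..<d} \<times> {..<d}"
  have into: "(\<lambda>x. (\<alpha> x, \<beta> x)) ` X \<subseteq> ?S"
    using assms by (auto simp: Maps_def)
  have "(\<Prod>x\<in>X. entry_fun d (\<alpha> x) (\<beta> x) g) = (\<Prod>(i, j)\<in>?S. entry_fun d i j g ^ m (i, j))" for g :: "'f mat"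
  proof -
    have "(\<Prod>x\<in>X. entry_fun d (\<alpha> x) (\<beta> x) g)
        = (\<Prod>p\<in>?S. \<Prod>x\<in>{x\<in>X. (\<alpha> x, \<beta> x) = p}. entry_fun d (\<alpha> x) (\<beta> x) g)"
      by (rule prod.group[OF assms(1) _ into, symmetric]) simp
    also have "\<dots> = (\<Prod>p\<in>?S. entry_fun d (fst p) (snd p) g ^ m p)"
    proof (rule prod.cong[OF refl])
      fix p assume "p \<in> ?S"
      then show "(\<Prod>x\<in>{x\<in>X. (\<alpha> x, \<beta> x) = p}. entry_fun d (\<alpha> x) (\<beta> x) g)
          = entry_fun d (fst p) (snd p) g ^ m p"
        by (subst prod.cong[of _ _ _ "\<lambda>x. entry_fun d (fst p) (snd p) g"]) (auto simp: m_def)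
    qed
    finally show ?thesis by (simp add: case_prod_beta)
  qed
  then show "c_fun d X \<alpha> \<beta> = (monomial_fun d m :: 'f mat \<Rightarrow> 'f)"
    by (simp only: c_fun_def monomial_fun_def)
  have "(\<Sum>p\<in>?S. m p) = (\<Sum>p\<in>?S. \<Sum>x\<in>{x\<in>X. (\<alpha> x, \<beta> x) = p}. 1)"
    by (simp add: m_def)
  also have "\<dots> = (\<Sum>x\<in>X. 1)"
    by (rule sum.group[OF assms(1) _ into]) simp
  finally show "m \<in> exponents d (card X)"
    by (simp add: exponents_def m_def)
qed

lemma c_fun_in_coeff_space:
  assumes "X \<subseteq> {1..n}" "\<alpha> \<in> Maps d X" "\<beta> \<in> Maps d X"
  shows "c_fun d X \<alpha> \<beta> \<in> coeff_space d n"
proof -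
  have "finite X" using assms(1) finite_subset by blast
  moreover have "card X \<le> n" using card_mono[OF _ assms(1)] by simp
  ultimately show ?thesis
    using assms by (auto simp: c_fun_eq_monomial_fun(1) bounded_exponents_def
      intro!: monomial_fun_in_coeff_space c_fun_eq_monomial_fun(2) bexI[of _ "card X"])
qed

text \<open>A monomial of degree \<open>r\<close> is a product of \<open>r\<close> entry functions
  with repetitions, and these factors can be numbered from 1 to \<open>r\<close>. Hence the sets
  \<open>{1..r}\<close> with \<open>r \<le> n\<close> already provide all monomials of the
  coefficient space.\<close>

lemma monomial_fun_eq_c_fun:
  assumes "m \<in> exponents d r"
  shows "\<exists>\<alpha>\<in>Maps d {1..r}. \<exists>\<beta>\<in>Maps d {1..r}. monomial_fun d m = (c_fun d {1..r} \<alpha> \<beta> :: 'f::field mat \<Rightarrow> 'f)"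
  using assms
proof (induction r arbitrary: m)
  case 0
  \<comment> \<open>The only element of \<open>Maps d {}\<close> is the function with constant value
    \<open>undefined\<close>.\<close>
  have "monomial_fun d m = (c_fun d {1..0} (\<lambda>x. undefined) (\<lambda>x. undefined) :: 'f mat \<Rightarrow> 'f)"
    using 0 by (auto simp: monomial_fun_def c_fun_def exponents_def intro!: ext prod.neutral)
  then show ?case by (auto simp: Maps_def)
next
  case (Suc r)
  let ?S = "{..<d} \<times> {..<d}"
  have "(\<Sum>p\<in>?S. m p) \<noteq> 0" using Suc.prems by (simp add: exponents_def)
  \<comment> \<open>An entry \<open>p\<close> occurring in the monomial is split off; it becomes the
    factor at the new position \<open>Suc r\<close>.\<close>
  then obtain p where p: "p \<in> ?S" "m p \<noteq> 0"
    by (meson sum.not_neutral_contains_not_neutral)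
  obtain i j where ij: "p = (i, j)" by (cases p)
  let ?m = "m(p := m p - 1)"
  have "(\<Sum>q\<in>?S. m q) = m p + (\<Sum>q\<in>?S - {p}. m q)"
    using p by (intro sum.remove) auto
  moreover have "(\<Sum>q\<in>?S. ?m q) = ?m p + (\<Sum>q\<in>?S - {p}. ?m q)"
    using p by (intro sum.remove) auto
  moreover have "(\<Sum>q\<in>?S - {p}. ?m q) = (\<Sum>q\<in>?S - {p}. m q)"
    by (intro sum.cong) auto
  ultimately have "?m \<in> exponents d r"
    using Suc.prems p by (auto simp: exponents_def PiE_iff extensional_def)
  then obtain \<alpha> \<beta> where ab: "\<alpha> \<in> Maps d {1..r}" "\<beta> \<in> Maps d {1..r}"
    "monomial_fun d ?m = (c_fun d {1..r} \<alpha> \<beta> :: 'f mat \<Rightarrow> 'f)"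
    using Suc.IH by blast
  have "monomial_fun d m = (c_fun d {1..Suc r} (\<alpha>(Suc r := i)) (\<beta>(Suc r := j)) :: 'f mat \<Rightarrow> 'f)"
  proof
    fix g :: "'f mat"
    show "monomial_fun d m g = c_fun d {1..Suc r} (\<alpha>(Suc r := i)) (\<beta>(Suc r := j)) g"
    proof (cases "g \<in> carrier (GL d)")
      case True
      let ?e = "\<lambda>q. entry_fun d (fst q) (snd q) g"
      have "monomial_fun d m g = (\<Prod>q\<in>?S. ?e q ^ m q)"
        using True by (simp add: monomial_fun_def case_prod_beta)
      also have "\<dots> = ?e p ^ m p * (\<Prod>q\<in>?S - {p}. ?e q ^ m q)"
        using p by (intro prod.remove) auto
      also have "\<dots> = ?e p * (?e p ^ ?m p * (\<Prod>q\<in>?S - {p}. ?e q ^ ?m q))"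
        using p by (simp add: power_eq_if[of _ "m p"])
      also have "?e p ^ ?m p * (\<Prod>q\<in>?S - {p}. ?e q ^ ?m q) = (\<Prod>q\<in>?S. ?e q ^ ?m q)"
        using p by (intro prod.remove[symmetric]) auto
      also have "\<dots> = c_fun d {1..r} \<alpha> \<beta> g"
        unfolding ab(3)[symmetric] using True
        by (simp add: monomial_fun_def case_prod_beta del: fun_upd_apply)
      also have "\<dots> = (\<Prod>x\<in>{1..r}. entry_fun d (\<alpha> x) (\<beta> x) g)"
        using True by (simp add: c_fun_def)
      also have "?e p * \<dots> = c_fun d {1..Suc r} (\<alpha>(Suc r := i)) (\<beta>(Suc r := j)) g"
        using True by (auto simp: c_fun_def ij atLeastAtMostSuc_conv intro!: prod.cong)
      finally show ?thesis .
    qed (simp add: monomial_fun_def c_fun_def)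
  qed
  moreover have "\<alpha>(Suc r := i) \<in> Maps d {1..Suc r}" "\<beta>(Suc r := j) \<in> Maps d {1..Suc r}"
    using ab p by (auto simp: Maps_def PiE_iff extensional_def ij)
  ultimately show ?case by blast
qed

section \<open>The evaluation homomorphism\<close>

lemma dual_spaceD:
  assumes "\<xi> \<in> dual_space d n"
  shows "\<lbrakk>f \<in> coeff_space d n; h \<in> coeff_space d n\<rbrakk> \<Longrightarrow> \<xi> (\<lambda>g. f g + h g) = \<xi> f + \<xi> h"
    and "f \<in> coeff_space d n \<Longrightarrow> \<xi> (\<lambda>g. c * f g) = c * \<xi> f"
    and "f \<notin> coeff_space d n \<Longrightarrow> \<xi> f = 0"
  using assms unfolding dual_space_def by blast+

lemma dual_space_sum:
  assumes \<xi>: "\<xi> \<in> dual_space d n" and "finite I" "\<And>i. i \<in> I \<Longrightarrow> f i \<in> coeff_space d n"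
  shows "\<xi> (\<lambda>g. \<Sum>i\<in>I. c i * f i g) = (\<Sum>i\<in>I. c i * \<xi> (f i))"
  using assms(2,3)
proof (induction I rule: finite_induct)
  case empty
  have "(\<lambda>g. 0) \<in> coeff_space d n"
    using coeff_space_sum[of "{}"] by simp
  then show ?case
    using dual_spaceD(2)[OF \<xi>, of "\<lambda>g. 0" 0] by simp
next
  case (insert j I)
  then have "\<xi> (\<lambda>g. c j * f j g + (\<Sum>i\<in>I. c i * f i g))
      = \<xi> (\<lambda>g. c j * f j g) + \<xi> (\<lambda>g. \<Sum>i\<in>I. c i * f i g)"
    by (intro dual_spaceD(1)[OF \<xi>] coeff_space_scale coeff_space_sum) auto
  then show ?case
    using insert dual_spaceD(2)[OF \<xi>] by simp
qed

text \<open>Every monomial is some \<open>c_fun\<close>, so these functions span the coefficient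
  space, and off that space both functionals vanish by convention. This gives the uniqueness behind
  the descriptions \<open>counit\<close> and \<open>dual_mult\<close>.\<close>

lemma dual_space_eqI:
  assumes \<xi>: "\<xi> \<in> dual_space d n" and \<eta>: "\<eta> \<in> dual_space d n"
    and eq: "\<And>X \<alpha> \<beta>. X \<subseteq> {1..n} \<Longrightarrow> \<alpha> \<in> Maps d X \<Longrightarrow> \<beta> \<in> Maps d X
      \<Longrightarrow> \<xi> (c_fun d X \<alpha> \<beta>) = \<eta> (c_fun d X \<alpha> \<beta> :: 'f::field mat \<Rightarrow> 'f)"
  shows "\<xi> = \<eta>"
proof
  fix f :: "'f mat \<Rightarrow> 'f"
  show "\<xi> f = \<eta> f"
  proof (cases "f \<in> coeff_space d n")
    case True
    then obtain a where f: "f = (\<lambda>g. \<Sum>m\<in>bounded_exponents d n. a m * monomial_fun d m g)"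
      by (auto simp: coeff_space_eq)
    have "\<xi> (monomial_fun d m) = \<eta> (monomial_fun d m)" if m: "m \<in> bounded_exponents d n" for m
    proof -
      obtain r where r: "r \<le> n" "m \<in> exponents d r"
        using m by (auto simp: bounded_exponents_def)
      obtain \<alpha> \<beta> where "\<alpha> \<in> Maps d {1..r}" "\<beta> \<in> Maps d {1..r}"
        "monomial_fun d m = (c_fun d {1..r} \<alpha> \<beta> :: 'f mat \<Rightarrow> 'f)"
        using monomial_fun_eq_c_fun[OF r(2)] by blast
      then show ?thesis
        using eq[of "{1..r}" \<alpha> \<beta>] r(1) by simp
    qed
    then show ?thesis
      unfolding f using \<xi> \<eta>
      by (simp add: dual_space_sum finite_bounded_exponents monomial_fun_in_coeff_space)
  next
    case False
    then show ?thesis using dual_spaceD(3) \<xi> \<eta> by metis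
  qed
qed

text \<open>The homomorphism \<pi> on the group algebra. Values off the coefficient space are set to
  0 to match the convention of \<open>dual_space\<close>.\<close>

definition evaluation ::
  "nat \<Rightarrow> nat \<Rightarrow> ('f::field mat \<Rightarrow> 'f) \<Rightarrow> ('f mat \<Rightarrow> 'f) \<Rightarrow> 'f" where
  "evaluation d n a = (\<lambda>f. if f \<in> coeff_space d n then pairing a f else 0)"

lemma evaluation_eq: "f \<in> coeff_space d n \<Longrightarrow> evaluation d n a f = pairing a f"
  by (simp add: evaluation_def)

lemma evaluation_in_dual_space: "evaluation d n a \<in> dual_space d n"
  unfolding dual_space_def
  by (auto simp: evaluation_def coeff_space_add coeff_space_scale pairing_add_right pairing_scale_right)

lemma evaluation_sum:
  assumes "finite I" "\<And>i. i \<in> I \<Longrightarrow> u i \<in> carrier (group_algebra (GL d))"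
  shows "evaluation d n (\<lambda>g. \<Sum>i\<in>I. t i * u i g) f = (\<Sum>i\<in>I. t i * evaluation d n (u i) f)"
  using assms by (simp add: evaluation_def pairing_sum_left)

section \<open>The general linear group and the comultiplication\<close>

lemma carrier_GL: "g \<in> carrier (GL d) \<Longrightarrow> g \<in> carrier_mat d d"
  by (simp add: GL_def units_of_def Units_def ring_mat_simps)

lemma mult_GL [simp]: "mult (GL d) = (*)"
  by (simp add: GL_def units_of_def ring_mat_simps)

lemma one_GL [simp]: "one (GL d) = 1\<^sub>m d"
  by (simp add: GL_def units_of_def ring_mat_simps)

lemma group_GL: "group (GL d :: 'f::field mat monoid)"
proof -
  interpret ring "ring_mat TYPE('f) d ()" by (rule ring_mat)
  show ?thesis unfolding GL_def by (rule units_group)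
qed

text \<open>Each entry of \<open>g * h\<close> is a sum over an intermediate index. Expanding the
  product of these sums over \<open>X\<close> chooses one index for each \<open>x\<close>, that is,
  a map \<gamma>.\<close>

lemma c_fun_mult:
  assumes "finite X" "\<alpha> \<in> Maps d X" "\<beta> \<in> Maps d X"
    and g: "g \<in> carrier (GL d)" and h: "h \<in> carrier (GL d)"
  shows "c_fun d X \<alpha> \<beta> (g * h) = (\<Sum>\<gamma>\<in>Maps d X. c_fun d X \<alpha> \<gamma> g * c_fun d X \<gamma> \<beta> (h :: 'f::field mat))"
proof -
  have gh: "g * h \<in> carrier (GL d)"
    using monoid.m_closed[OF group.is_monoid[OF group_GL] g h] by simp
  have "(g * h) $$ (\<alpha> x, \<beta> x) = (\<Sum>k<d. g $$ (\<alpha> x, k) * h $$ (k, \<beta> x))" if "x \<in> X" for x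
  proof -
    have "\<alpha> x < d" "\<beta> x < d" using that assms by (auto simp: Maps_def)
    then show ?thesis
      using carrier_GL[OF g] carrier_GL[OF h] by (simp add: scalar_prod_def lessThan_atLeast0)
  qed
  then have "c_fun d X \<alpha> \<beta> (g * h) = (\<Prod>x\<in>X. \<Sum>k<d. g $$ (\<alpha> x, k) * h $$ (k, \<beta> x))"
    using gh by (simp add: c_fun_def entry_fun_def)
  also have "\<dots> = (\<Sum>\<gamma>\<in>Maps d X. \<Prod>x\<in>X. g $$ (\<alpha> x, \<gamma> x) * h $$ (\<gamma> x, \<beta> x))"
    unfolding Maps_def by (rule prod_sum_PiE) (use assms in auto)
  also have "\<dots> = (\<Sum>\<gamma>\<in>Maps d X. c_fun d X \<alpha> \<gamma> g * c_fun d X \<gamma> \<beta> h)"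
    using g h by (simp add: c_fun_def entry_fun_def prod.distrib)
  finally show ?thesis .
qed

text \<open>Pairing with a convolution evaluates functions at products, where
  \<open>c_fun_mult\<close> yields the sum over \<gamma> that characterises
  \<open>dual_mult\<close>; by \<open>dual_space_eqI\<close> there is no other solution.\<close>

lemma dual_mult_evaluation:
  assumes a: "a \<in> carrier (group_algebra (GL d))" and b: "b \<in> carrier (group_algebra (GL d))"
  shows "dual_mult d n (evaluation d n a) (evaluation d n b)
    = evaluation d n (mult (group_algebra (GL d)) a b)"
  unfolding dual_mult_def
proof (rule the_equality)
  have *: "evaluation d n (mult (group_algebra (GL d)) a b) (c_fun d X \<alpha> \<beta>)
      = (\<Sum>\<gamma>\<in>Maps d X. evaluation d n a (c_fun d X \<alpha> \<gamma>) * evaluation d n b (c_fun d X \<gamma> \<beta>))"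
    if X: "X \<subseteq> {1..n}" and \<alpha>: "\<alpha> \<in> Maps d X" and \<beta>: "\<beta> \<in> Maps d X" for X \<alpha> \<beta>
  proof -
    have fin: "finite X" using X finite_subset by blast
    have "evaluation d n (mult (group_algebra (GL d)) a b) (c_fun d X \<alpha> \<beta>)
        = pairing a (\<lambda>g. pairing b (\<lambda>h. c_fun d X \<alpha> \<beta> (g * h)))"
      using group.pairing_mult[OF group_GL a b]
      by (simp add: evaluation_eq[OF c_fun_in_coeff_space[OF X \<alpha> \<beta>]])
    \<comment> \<open>The expansion is stated for group elements, and \<open>a\<close> and
      \<open>b\<close> are supported there.\<close>
    also have "\<dots> = pairing a (\<lambda>g. pairing b (\<lambda>h. \<Sum>\<gamma>\<in>Maps d X. c_fun d X \<alpha> \<gamma> g * c_fun d X \<gamma> \<beta> h))"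
      using a b by (intro pairing_cong c_fun_mult[OF fin \<alpha> \<beta>]) auto
    \<comment> \<open>For fixed \<open>g\<close> the sum is a combination of functions of
      \<open>h\<close>; linearity is used in \<open>h\<close> first and in \<open>g\<close>
      afterwards.\<close>
    also have "\<dots> = pairing a (\<lambda>g. \<Sum>\<gamma>\<in>Maps d X. pairing b (c_fun d X \<gamma> \<beta>) * c_fun d X \<alpha> \<gamma> g)"
      by (intro pairing_cong) (subst pairing_sum_right, simp add: mult.commute)
    also have "\<dots> = (\<Sum>\<gamma>\<in>Maps d X. pairing a (c_fun d X \<alpha> \<gamma>) * pairing b (c_fun d X \<gamma> \<beta>))"
      by (subst pairing_sum_right) (simp add: mult.commute)
    also have "\<dots> = (\<Sum>\<gamma>\<in>Maps d X. evaluation d n a (c_fun d X \<alpha> \<gamma>) * evaluation d n b (c_fun d X \<gamma> \<beta>))"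
      by (intro sum.cong) (simp_all add: evaluation_eq c_fun_in_coeff_space[OF X] \<alpha> \<beta>)
    finally show ?thesis .
  qed
  then show "evaluation d n (mult (group_algebra (GL d)) a b) \<in> dual_space d n \<and>
    (\<forall>X\<subseteq>{1..n}. \<forall>\<alpha>\<in>Maps d X. \<forall>\<beta>\<in>Maps d X.
      evaluation d n (mult (group_algebra (GL d)) a b) (c_fun d X \<alpha> \<beta>)
      = (\<Sum>\<gamma>\<in>Maps d X. evaluation d n a (c_fun d X \<alpha> \<gamma>) * evaluation d n b (c_fun d X \<gamma> \<beta>)))"
    using evaluation_in_dual_space by blast
  fix \<zeta> assume \<zeta>: "\<zeta> \<in> dual_space d n \<and> (\<forall>X\<subseteq>{1..n}. \<forall>\<alpha>\<in>Maps d X. \<forall>\<beta>\<in>Maps d X.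
      \<zeta> (c_fun d X \<alpha> \<beta>)
      = (\<Sum>\<gamma>\<in>Maps d X. evaluation d n a (c_fun d X \<alpha> \<gamma>) * evaluation d n b (c_fun d X \<gamma> \<beta>)))"
  show "\<zeta> = evaluation d n (mult (group_algebra (GL d)) a b)"
    by (rule dual_space_eqI[of _ d n]) (use \<zeta> * evaluation_in_dual_space in auto)
qed

text \<open>At the unit matrix the entry functions are Kronecker deltas, and their product over
  \<open>X\<close> is 1 exactly when \<alpha> and \<beta> agree on \<open>X\<close>.\<close>

lemma counit_eq_evaluation:
  "counit d n = evaluation d n (group_elem (1\<^sub>m d :: 'f::field mat))"
  unfolding counit_def
proof (rule the_equality)
  have one: "(1\<^sub>m d :: 'f mat) \<in> carrier (GL d)"
    using monoid.one_closed[OF group.is_monoid[OF group_GL[of d]]] by simp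
  have *: "evaluation d n (group_elem (1\<^sub>m d :: 'f mat)) (c_fun d X \<alpha> \<beta>) = (if \<alpha> = \<beta> then 1 else 0)"
    if X: "X \<subseteq> {1..n}" and \<alpha>: "\<alpha> \<in> Maps d X" and \<beta>: "\<beta> \<in> Maps d X" for X \<alpha> \<beta>
  proof -
    have fin: "finite X" using X finite_subset by blast
    have "evaluation d n (group_elem (1\<^sub>m d :: 'f mat)) (c_fun d X \<alpha> \<beta>)
        = (\<Prod>x\<in>X. (1\<^sub>m d :: 'f mat) $$ (\<alpha> x, \<beta> x))"
      unfolding evaluation_eq[OF c_fun_in_coeff_space[OF X \<alpha> \<beta>]]
      using one by (simp add: c_fun_def entry_fun_def)
    also have "\<dots> = (\<Prod>x\<in>X. if \<alpha> x = \<beta> x then 1 else 0)"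
      by (intro prod.cong) (use \<alpha> \<beta> in \<open>auto simp: Maps_def PiE_iff\<close>)
    also have "\<dots> = (if \<alpha> = \<beta> then 1 else 0)"
    proof (cases "\<alpha> = \<beta>")
      case False
      \<comment> \<open>Elements of \<open>Maps d X\<close> are extensional, so distinct ones differ
        at a point of \<open>X\<close>.\<close>
      then have "\<exists>x\<in>X. \<alpha> x \<noteq> \<beta> x"
        using \<alpha> \<beta> PiE_ext[of \<alpha> X _ \<beta>] unfolding Maps_def by blast
      then show ?thesis using False fin by (auto intro: prod_zero)
    qed simp
    finally show ?thesis .
  qed
  then show "evaluation d n (group_elem (1\<^sub>m d :: 'f mat)) \<in> dual_space d n \<and>
    (\<forall>X\<subseteq>{1..n}. \<forall>\<alpha>\<in>Maps d X. \<forall>\<beta>\<in>Maps d X.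
      evaluation d n (group_elem (1\<^sub>m d :: 'f mat)) (c_fun d X \<alpha> \<beta>) = (if \<alpha> = \<beta> then 1 else 0))"
    using evaluation_in_dual_space by blast
  fix \<zeta> :: "('f mat \<Rightarrow> 'f) \<Rightarrow> 'f"
  assume \<zeta>: "\<zeta> \<in> dual_space d n \<and> (\<forall>X\<subseteq>{1..n}. \<forall>\<alpha>\<in>Maps d X. \<forall>\<beta>\<in>Maps d X.
      \<zeta> (c_fun d X \<alpha> \<beta>) = (if \<alpha> = \<beta> then 1 else 0))"
  show "\<zeta> = evaluation d n (group_elem (1\<^sub>m d))"
    by (rule dual_space_eqI[of _ d n]) (use \<zeta> * evaluation_in_dual_space in auto)
qed

lemma evaluation_surj:
  "evaluation d n ` carrier (group_algebra (GL d)) = (dual_space d n :: (('f::field mat \<Rightarrow> 'f) \<Rightarrow> 'f) set)"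
proof (intro equalityI subsetI)
  fix \<xi> :: "('f mat \<Rightarrow> 'f) \<Rightarrow> 'f"
  assume \<xi>: "\<xi> \<in> dual_space d n"
  obtain B :: "('f mat \<Rightarrow> 'f) set" and u where B: "finite B" "B \<subseteq> coeff_space d n"
    and u: "\<And>i. i \<in> B \<Longrightarrow> u i \<in> carrier (group_algebra (GL d))"
    and span: "\<And>f. f \<in> coeff_space d n \<Longrightarrow> f = (\<lambda>g. \<Sum>i\<in>B. pairing (u i) f * i g)"
    by (rule coeff_space_dual_system[of d n]) (rule that)
  \<comment> \<open>Its pairing with \<open>f\<close> is the sum of
    \<open>\<xi> i * pairing (u i) f\<close>, which is \<xi> applied to the expansion of
    \<open>f\<close> in \<open>B\<close>.\<close>
  let ?a = "\<lambda>g. \<Sum>i\<in>B. \<xi> i * u i g"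
  have "{g. ?a g \<noteq> 0} \<subseteq> carrier (GL d)"
    using u by (fastforce intro: sum.neutral)
  then have a: "?a \<in> carrier (group_algebra (GL d))"
    using finite_support_sum[OF B(1), of u \<xi>] u by auto
  have "\<xi> = evaluation d n ?a"
  proof
    fix f
    show "\<xi> f = evaluation d n ?a f"
    proof (cases "f \<in> coeff_space d n")
      case True
      have "\<xi> f = \<xi> (\<lambda>g. \<Sum>i\<in>B. pairing (u i) f * i g)"
        using span[OF True] by (rule arg_cong)
      also have "\<dots> = (\<Sum>i\<in>B. pairing (u i) f * \<xi> i)"
        using dual_space_sum[OF \<xi> B(1), of "\<lambda>i. i" "\<lambda>i. pairing (u i) f"] B(2) by auto
      also have "\<dots> = evaluation d n ?a f"
        using True by (simp add: evaluation_sum[OF B(1) u]) (simp add: evaluation_def mult.commute)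
      finally show ?thesis .
    next
      case False
      then show ?thesis using dual_spaceD(3)[OF \<xi>] by (simp add: evaluation_def)
    qed
  qed
  then show "\<xi> \<in> evaluation d n ` carrier (group_algebra (GL d))"
    using a by blast
qed (use evaluation_in_dual_space in auto)

lemma algebra_surjection_evaluation:
  "algebra_surjection (group_algebra (GL d)) (extended_schur_algebra d n)
    (evaluation d n :: ('f::field mat \<Rightarrow> 'f) \<Rightarrow> ('f mat \<Rightarrow> 'f) \<Rightarrow> 'f)"
proof (intro algebra_surjection.intro algebra_surjection_axioms.intro)
  let ?FG = "group_algebra (GL d) :: ('f, 'f mat \<Rightarrow> 'f) module"
  let ?S = "extended_schur_algebra d n :: ('f, ('f mat \<Rightarrow> 'f) \<Rightarrow> 'f) module"
  show "assoc_algebra ?FG"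
    by (rule group.assoc_algebra_group_algebra[OF group_GL])
  show "evaluation d n ` carrier ?FG = carrier ?S"
    by (simp add: extended_schur_algebra_def evaluation_surj del: group_algebra_simps)
  show "evaluation d n \<one>\<^bsub>?FG\<^esub> = \<one>\<^bsub>?S\<^esub>"
    by (simp add: extended_schur_algebra_def counit_eq_evaluation)
  show "evaluation d n \<zero>\<^bsub>?FG\<^esub> = \<zero>\<^bsub>?S\<^esub>"
    by (simp add: extended_schur_algebra_def evaluation_def pairing_def fun_eq_iff)
  fix a b :: "'f mat \<Rightarrow> 'f" and c :: 'f
  assume a: "a \<in> carrier ?FG"
  show "evaluation d n (c \<odot>\<^bsub>?FG\<^esub> a) = c \<odot>\<^bsub>?S\<^esub> evaluation d n a"
    by (simp add: extended_schur_algebra_def evaluation_def pairing_scale_left fun_eq_iff)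
  assume b: "b \<in> carrier ?FG"
  show "evaluation d n (a \<oplus>\<^bsub>?FG\<^esub> b) = evaluation d n a \<oplus>\<^bsub>?S\<^esub> evaluation d n b"
    using a b by (simp add: extended_schur_algebra_def evaluation_def pairing_add_left fun_eq_iff)
  show "evaluation d n (a \<otimes>\<^bsub>?FG\<^esub> b) = evaluation d n a \<otimes>\<^bsub>?S\<^esub> evaluation d n b"
    using dual_mult_evaluation[OF a b] by (simp add: extended_schur_algebra_def)
qed

section \<open>Coefficient functions\<close>

text \<open>Coefficient functions describe the action of group elements only; this expansion extends
  the description to every \<open>a\<close>.\<close>

lemma group_algebra_eq_finsum:
  assumes a: "a \<in> carrier (group_algebra (GL d))"
  shows "a = (\<Oplus>\<^bsub>group_algebra (GL d)\<^esub>g\<in>{g. a g \<noteq> 0}.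
    a g \<odot>\<^bsub>group_algebra (GL d)\<^esub> (group_elem g :: 'f::field mat \<Rightarrow> 'f))"
proof -
  interpret G: group "GL d :: 'f mat monoid" by (rule group_GL)
  interpret assoc_algebra "group_algebra (GL d) :: ('f, 'f mat \<Rightarrow> 'f) module"
    by (rule G.assoc_algebra_group_algebra)
  have "a g \<odot>\<^bsub>group_algebra (GL d)\<^esub> group_elem g \<in> carrier (group_algebra (GL d))"
    if "a g \<noteq> 0" for g
    using that a by (intro V.smult_closed G.group_elem_closed) auto
  then have "(\<Oplus>\<^bsub>group_algebra (GL d)\<^esub>g\<in>{g. a g \<noteq> 0}. a g \<odot>\<^bsub>group_algebra (GL d)\<^esub> group_elem g)
      = (\<lambda>h. \<Sum>g\<in>{g. a g \<noteq> 0}. (a g \<odot>\<^bsub>group_algebra (GL d)\<^esub> group_elem g) h)"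
    using a by (intro G.finsum_group_algebra) auto
  also have "\<dots> = a"
    using a by (auto simp: group_elem_def if_distrib fun_eq_iff cong: if_cong)
  finally show ?thesis ..
qed

lemma coefficients_in_iff:
  fixes M :: "('f::field mat \<Rightarrow> 'f, 'v) module"
  assumes M: "fd_left_module (group_algebra (GL d)) M"
  shows "coefficients_in d (coeff_space d n) M
    \<longleftrightarrow> algebra_surjection.kernel_annihilates (group_algebra (GL d)) (extended_schur_algebra d n) (evaluation d n) M"
proof -
  let ?FG = "group_algebra (GL d) :: ('f, 'f mat \<Rightarrow> 'f) module"
  let ?S = "extended_schur_algebra d n :: ('f, ('f mat \<Rightarrow> 'f) \<Rightarrow> 'f) module"
  let ?U = "underlying_space ?FG M"
  interpret G: group "GL d :: 'f mat monoid" by (rule group_GL)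
  interpret E: algebra_surjection ?FG ?S "evaluation d n" by (rule algebra_surjection_evaluation)
  interpret M: left_module ?FG M using M by (simp add: fd_left_module_def)
  show ?thesis
  proof
    assume "coefficients_in d (coeff_space d n) M"
    then obtain B \<phi> where B: "finite B" "M.U.basis B"
      and \<phi>: "coefficient_functions d M B \<phi>" and in_space: "\<And>a b. a \<in> B \<Longrightarrow> b \<in> B \<Longrightarrow> \<phi> a b \<in> coeff_space d n"
      unfolding coefficients_in_def by blast
    have BM: "B \<subseteq> carrier M" using B(2) by (simp add: M.U.basis_def)
    show "E.kernel_annihilates M"
      unfolding E.kernel_annihilates_def
    proof (intro ballI impI)
      fix a v assume a: "a \<in> carrier ?FG" and "evaluation d n a = \<zero>\<^bsub>?S\<^esub>" and v: "v \<in> carrier M"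
      then have 0: "pairing a f = 0" if "f \<in> coeff_space d n" for f
        using that by (simp add: extended_schur_algebra_def evaluation_def fun_eq_iff) metis
      have "a \<odot>\<^bsub>M\<^esub> b = \<zero>\<^bsub>M\<^esub>" if b: "b \<in> B" for b
      proof -
        have "a \<odot>\<^bsub>M\<^esub> b = (\<Oplus>\<^bsub>?FG\<^esub>g\<in>{g. a g \<noteq> 0}. a g \<odot>\<^bsub>?FG\<^esub> group_elem g) \<odot>\<^bsub>M\<^esub> b"
          using group_algebra_eq_finsum[OF a] by (rule arg_cong)
        \<comment> \<open>The matrix entries of \<open>a\<close> are its pairings with the
          coefficient functions, and these vanish because the coefficient functions lie in the
          coefficient space.\<close>
        also have "\<dots> = M.U.lincomb (\<lambda>b'. \<Sum>g\<in>{g. a g \<noteq> 0}. a g * \<phi> b' b g) B"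
        proof (rule M.act_finsum_lincomb)
          show "finite {g. a g \<noteq> 0}" using a by simp
          fix g assume "g \<in> {g. a g \<noteq> 0}"
          then have g: "g \<in> carrier (GL d)" using a by auto
          then show "group_elem g \<in> carrier ?FG" by (rule G.group_elem_closed)
          show "group_elem g \<odot>\<^bsub>M\<^esub> b = M.U.lincomb (\<lambda>b'. \<phi> b' b g) B"
            using \<phi> g b by (simp add: coefficient_functions_def)
        qed (use B BM b in auto)
        also have "\<dots> = M.U.lincomb (\<lambda>b'. 0) B"
        proof (rule M.U.lincomb_cong)
          show "(\<Sum>g\<in>{g. a g \<noteq> 0}. a g * \<phi> b' b g) = 0" if "b' \<in> B" for b'
            using 0[OF in_space[OF that b]] by (simp add: pairing_def)
        qed (use BM in auto)
        also have "\<dots> = \<zero>\<^bsub>M\<^esub>"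
          by (rule M.lincomb_zero[OF BM])
        finally show ?thesis .
      qed
      then show "a \<odot>\<^bsub>M\<^esub> v = \<zero>\<^bsub>M\<^esub>"
        by (rule M.act_eq_zero_if_basis[OF a B(2) _ v])
    qed
  next
    assume ann: "E.kernel_annihilates M"
    obtain C where C: "finite C" "M.U.basis C"
      using M M.U.finite_basis_exists by (auto simp: fd_left_module_def)
    then have CM: "C \<subseteq> carrier M" by (simp add: M.U.basis_def)
    obtain B :: "('f mat \<Rightarrow> 'f) set" and u where B: "finite B" "B \<subseteq> coeff_space d n"
      and u: "\<And>i. i \<in> B \<Longrightarrow> u i \<in> carrier ?FG"
      and span: "\<And>f. f \<in> coeff_space d n \<Longrightarrow> f = (\<lambda>g. \<Sum>i\<in>B. pairing (u i) f * i g)"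
      by (rule coeff_space_dual_system[of d n]) (rule that)
    have "\<exists>c. u i \<odot>\<^bsub>M\<^esub> b = M.U.lincomb c C" if "i \<in> B" "b \<in> C" for i b
    proof -
      have "u i \<odot>\<^bsub>M\<^esub> b \<in> M.U.span C"
        using M.act_closed[OF u[OF that(1)]] that(2) CM C(2) by (auto simp: M.U.basis_def)
      then obtain c where "M.U.lincomb c C = u i \<odot>\<^bsub>M\<^esub> b"
        using M.U.finite_in_span[OF C(1), of "u i \<odot>\<^bsub>M\<^esub> b"] CM by auto
      then show ?thesis
        by (intro exI[of _ c]) (rule sym)
    qed
    then obtain \<chi> where \<chi>: "\<And>i b. i \<in> B \<Longrightarrow> b \<in> C \<Longrightarrow> u i \<odot>\<^bsub>M\<^esub> b = M.U.lincomb (\<chi> i b) C"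
      by metis
    \<comment> \<open>\<open>u i\<close> has the constant matrix entries
      \<open>\<chi> i b b'\<close>, and \<open>g\<close> will turn out to act as the sum of the
      \<open>i g * u i\<close>; these are the entries of that sum as functions of
      \<open>g\<close>.\<close>
    let ?\<phi> = "\<lambda>b' b g. \<Sum>i\<in>B. \<chi> i b b' * i g"
    have \<phi>: "?\<phi> b' b \<in> coeff_space d n" for b' b
      using B by (intro coeff_space_sum) auto
    have "group_elem g \<odot>\<^bsub>M\<^esub> b = M.U.lincomb (\<lambda>b'. ?\<phi> b' b g) C"
      if g: "g \<in> carrier (GL d)" and b: "b \<in> C" for g b
    proof -
      let ?z = "\<Oplus>\<^bsub>?FG\<^esub>i\<in>B. i g \<odot>\<^bsub>?FG\<^esub> u i"
      have z: "?z = (\<lambda>h. \<Sum>i\<in>B. i g * u i h)"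
        using G.finsum_group_algebra[OF B(1), of "\<lambda>i. i g \<odot>\<^bsub>?FG\<^esub> u i"]
          E.A.V.smult_closed[OF _ u] by simp
      \<comment> \<open>By the expansion of \<open>f\<close> in \<open>B\<close>, \<open>g\<close>
        and \<open>?z\<close> take the same values on the coefficient space, so they have the same
        image and act alike.\<close>
      have "evaluation d n (group_elem g) = evaluation d n ?z"
      proof
        fix f
        show "evaluation d n (group_elem g) f = evaluation d n ?z f"
        proof (cases "f \<in> coeff_space d n")
          case True
          have "f g = (\<Sum>i\<in>B. pairing (u i) f * i g)"
            using span[OF True] by (rule fun_cong)
          also have "\<dots> = pairing (\<lambda>h. \<Sum>i\<in>B. i g * u i h) f"
            using pairing_sum_left[of B u "\<lambda>i. i g" f] B(1) u by (simp add: mult.commute)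
          finally show ?thesis
            unfolding z using True by (simp add: evaluation_eq)
        qed (simp add: evaluation_def)
      qed
      then have "group_elem g \<odot>\<^bsub>M\<^esub> b = ?z \<odot>\<^bsub>M\<^esub> b"
        using b CM u G.group_elem_closed[OF g]
        by (intro E.act_cong[OF M.left_module_axioms ann])
          (auto intro!: E.A.R.finsum_closed E.A.V.smult_closed simp del: group_algebra_simps)
      also have "\<dots> = M.U.lincomb (\<lambda>b'. \<Sum>i\<in>B. i g * \<chi> i b b') C"
        by (rule M.act_finsum_lincomb) (use B u C CM \<chi> b in auto)
      finally show ?thesis by (simp add: mult.commute)
    qed
    \<comment> \<open>The required vanishing outside the group is inherited from the coefficient
      space.\<close>
    then have "coefficient_functions d M C ?\<phi>"
      using coeff_space_outside[OF \<phi>] by (auto simp: coefficient_functions_def)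
    then show "coefficients_in d (coeff_space d n) M"
      using C \<phi> unfolding coefficients_in_def by blast
  qed
qed

text \<open>Evaluation is the surjection along which actions are changed, and
  \<open>coefficients_in_iff\<close> recognises the coefficient condition as annihilation by its
  kernel.\<close>

theorem proposition7:
  fixes d n :: nat
  assumes "infinite (UNIV :: 'f::field set)"
    and "1 \<le> n" and "n \<le> d"
  shows "equivalent_categories
    (full_subcategory
      (fd_module_category (group_algebra (GL d))
        :: (('f mat \<Rightarrow> 'f, 'v) module, 'v \<Rightarrow> 'v) cat)
      (coefficients_in d (coeff_space d n)))
    (fd_module_category (extended_schur_algebra d n)
      :: ((('f mat \<Rightarrow> 'f) \<Rightarrow> 'f, 'v) module, 'v \<Rightarrow> 'v) cat)"
  by (rule algebra_surjection.equivalent_categories_annihilated[OF algebra_surjection_evaluation coefficients_in_iff])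

end
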